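(* Let $F$ be a stochastic functional on the configuration space $\Omega^X$ such that there exist a non-negative and non-decreasing function $\beta$, defined on $\mathbb R_+$, and a constant $C>0$ such that for all $R$ greater than a given $R_0$: (i) $\sup_{y\in B_X(0,R)}|D_yF(\omega)|\le\beta(R)$, $P(d\omega)$-a.s., (ii) $\|DF\|^2_{L^\infty(\Omega^X,L^2(\nu_R))}\le C\,\beta^2(R)\,\gamma(R)$. Then $$P(F-m(F)\ge x)\le(1+Ce)\,\gamma\circ\beta^{-1}(x/4)$$ for all $$x\ge2\,\beta\left(\gamma^{-1}\left(\frac1{2(1+Ce)}\right)\right).$$
   Context: $X$ is a $\sigma$-compact metric space with distance $d_X$, $0\in X$ is an arbitrary fixed point, $B_X(0,R)=\{x\in X:d_X(0,x)\le R\}$. $\nu$ is a diffuse Radon measure on $X$, and $\nu_R(A)=\nu(A\cap B_X(0,R))$ for Borel sets $A\subset X$. $\Omega^X$ is the configuration space of Radon measures that are (finite or countable) sums of Dirac masses at distinct points of $X$, each identified with its support, and $P$ is the Poisson measure on $\Omega^X$ with intensity $\nu$. The finite difference operator is $D_yF(\omega)=F(\omega\cup\{y\})-F(\omega)$, and $\|DF\|_{L^\infty(\Omega^X,L^2(\nu_R))}$ is the $P$-essential supremum over $\omega$ of $(\int_{B_X(0,R)}|D_yF(\omega)|^2\nu(dy))^{1/2}$. $\gamma$ denotes a non-negative and non-increasing function such that $P(\{\omega\in\Omega^X:\omega\cap B_X(0,R)^c\ne\emptyset\})\le\gamma(R)$ for all $R$ large enough. $m(F)$ denotes a median of $F$,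 i.e. $P(F\ge m(F))\ge1/2$ and $P(F\le m(F))\ge1/2$. $\beta^{-1}$ and $\gamma^{-1}$ denote the inverses of the monotone functions $\beta$ and $\gamma$.
   Formalization: Proved for x>0, with γ^{-1}(1/(2(1+Ce))) or β^{-1}(x/4) above R_0 and the radius from which γ bounds the tail; β and γ are unconstrained below, where the claim can fail. β^{-1}(x/4) is any r≥0 with β(r)≤x/4≤β(R) for all R>r; nothing is claimed if none exists. *)

theory Defs
  imports "HOL-Probability.Probability"
begin

definition sigma_compact :: "'a::topological_space set \<Rightarrow> bool" where
  "sigma_compact S \<longleftrightarrow> (\<exists>K :: nat \<Rightarrow> 'a set. (\<forall>n. compact (K n)) \<and> (\<Union>n. K n) = S)"

text \<open>On a metric space, finiteness on compact sets together with inner regularity implies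
  local finiteness, so this agrees with the definition by local finiteness.\<close>

definition radon_measure :: "'a::metric_space measure \<Rightarrow> bool" where
  "radon_measure M \<longleftrightarrow>
     sets M = sets borel \<and>
     (\<forall>K. compact K \<longrightarrow> emeasure M K < \<infinity>) \<and>
     (\<forall>A\<in>sets borel. emeasure M A = (SUP K\<in>{K. compact K \<and> K \<subseteq> A}. emeasure M K))"

definition diffuse :: "'a::metric_space measure \<Rightarrow> bool" where
  "diffuse M \<longleftrightarrow> (\<forall>x. emeasure M {x} = 0)"

text \<open>The Borel measure \<open>\<Sum>x\<in>\<omega>. \<delta>\<^sub>x\<close>; its value at a Borel set \<open>A\<close> is the number of
  points of \<open>\<omega> \<inter> A\<close>, possibly \<open>\<infinity>\<close>.\<close>

definition dirac_sum :: "'a::metric_space set \<Rightarrow> 'a measure" where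
  "dirac_sum \<omega> = distr (count_space \<omega>) borel (\<lambda>x. x)"

text \<open>A configuration is represented by its support.\<close>

definition configurations :: "'a::metric_space set set" where
  "configurations = {\<omega>. countable \<omega> \<and> radon_measure (dirac_sum \<omega>)}"

definition config_space :: "'a::metric_space set measure" where
  "config_space = sigma configurations
     {{\<omega> \<in> configurations. emeasure (dirac_sum \<omega>) A \<in> B} | A B.
        A \<in> sets (borel :: 'a measure) \<and> B \<in> sets (borel :: ennreal measure)}"

definition poisson_measure :: "'a::metric_space measure \<Rightarrow> 'a set measure \<Rightarrow> bool" where
  "poisson_measure \<nu> P \<longleftrightarrow>
     prob_space P \<and> sets P = sets config_space \<and>
     (\<forall>A\<in>sets borel. emeasure \<nu> A < \<infinity> \<longrightarrow>
        (\<forall>n::nat. measure P {\<omega> \<in> space P. emeasure (dirac_sum \<omega>) A = of_nat n}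
                  = exp (- measure \<nu> A) * measure \<nu> A ^ n / fact n)) \<and>
     (\<forall>(n::nat) (A :: nat \<Rightarrow> 'a set).
        (\<forall>i<n. A i \<in> sets borel \<and> emeasure \<nu> (A i) < \<infinity>) \<and> disjoint_family_on A {..<n} \<longrightarrow>
        prob_space.indep_vars P (\<lambda>_. borel) (\<lambda>i \<omega>. emeasure (dirac_sum \<omega>) (A i)) {..<n})"

definition finite_diff :: "('a set \<Rightarrow> real) \<Rightarrow> 'a \<Rightarrow> 'a set \<Rightarrow> real" where
  "finite_diff F y \<omega> = F (\<omega> \<union> {y}) - F \<omega>"

definition restr_measure :: "'a::metric_space measure \<Rightarrow> 'a \<Rightarrow> real \<Rightarrow> 'a measure" where
  "restr_measure \<nu> a R = density \<nu> (indicator (cball a R))"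

definition L2_enorm :: "'a measure \<Rightarrow> ('a \<Rightarrow> real) \<Rightarrow> ennreal" where
  "L2_enorm M f =
     (let I = \<integral>\<^sup>+ y. ennreal (\<bar>f y\<bar>\<^sup>2) \<partial>M in if I = \<infinity> then \<infinity> else ennreal (sqrt (enn2real I)))"

definition Linf_L2_enorm :: "'b measure \<Rightarrow> 'a measure \<Rightarrow> ('a \<Rightarrow> 'b \<Rightarrow> real) \<Rightarrow> ennreal" where
  "Linf_L2_enorm P M G = esssup P (\<lambda>\<omega>. L2_enorm M (\<lambda>y. G y \<omega>))"

definition is_median :: "'b measure \<Rightarrow> ('b \<Rightarrow> real) \<Rightarrow> real \<Rightarrow> bool" where
  "is_median P F m \<longleftrightarrow>
     measure P {\<omega> \<in> space P. F \<omega> \<ge> m} \<ge> 1 / 2 \<and> measure P {\<omega> \<in> space P. F \<omega> \<le> m} \<ge> 1 / 2"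

text \<open>Values of the inverse of a monotone function on \<open>[0, \<infinity>)\<close> that need be neither strictly
  monotone nor continuous. Every solution \<open>r \<ge> 0\<close> of \<open>f r = y\<close> qualifies. At a jump of the
  function across \<open>y\<close>, \<open>decr_inverse\<close> admits the jump point without constraint, but
  \<open>incr_inverse\<close> requires that the function has not yet exceeded \<open>y\<close> there: with
  \<open>\<beta> r > y\<close> allowed, the tail estimate would fail when \<open>\<beta>\<close> and \<open>\<gamma>\<close> jump at the same point.\<close>

definition incr_inverse :: "(real \<Rightarrow> real) \<Rightarrow> real \<Rightarrow> real \<Rightarrow> bool" where
  "incr_inverse f y r \<longleftrightarrow> 0 \<le> r \<and> f r \<le> y \<and> (\<forall>R>r. y \<le> f R)"

definition decr_inverse :: "(real \<Rightarrow> real) \<Rightarrow> real \<Rightarrow> real \<Rightarrow> bool" where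
  "decr_inverse f y r \<longleftrightarrow> 0 \<le> r \<and> (\<forall>R. 0 \<le> R \<and> R < r \<longrightarrow> y \<le> f R) \<and> (\<forall>R>r. f R \<le> y)"

end

theory Submission
  imports Defs
begin

text \<open>Chebyshev's inequality on the event that the configuration lies in \<open>B = cball a r\<close> suffices:
  after clipping \<open>F\<close> around its median, the Poincare inequality
  \<open>Var F \<le> E \<integral>\<^bsub>B\<^esub> \<bar>D\<^sub>y F\<bar>\<^sup>2 \<nu>(dy)\<close> bounds the variance under the conditional law \<open>Q\<close> by
  \<open>C (x/4)\<^sup>2 \<gamma> r\<close>. Conditioning, rather than applying \<open>F\<close> to \<open>\<omega> \<inter> B\<close>, keeps almost sure
  hypotheses usable because \<open>Q\<close> is absolutely continuous.

  For the Poincare inequality on a set of finite intensity \<open>l\<close>, independent points are added to a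
  configuration with probability \<open>l/n\<close> each, \<open>n\<close> times; the variances of the single steps add up, and \<open>n \<rightarrow> \<infinity>\<close> gives
  a Poisson number of points. That this reproduces \<open>P\<close> inside the set follows
  from Renyi's theorem: a simple point process is determined by its void probabilities. As
  \<open>\<nu> B\<close> may be infinite, \<open>B\<close> is finally exhausted by sets of finite intensity.\<close>

section \<open>Bounded measurable functions\<close>

text \<open>The gradient bounds hold only almost surely, so they are usable only under laws
  absolutely continuous with respect to the Poisson law. The inequality for the walk holds from
  every starting state; integrated over the configuration cleared on a set, its energy term is again
  an expectation under the unchanged law, because resampling preserves that law. Only there are the
  almost sure bounds applied. The variances of single steps add up because inserting a point
  commutes with averaging over inserted points, so the energy does not grow along the walk. As
  \<open>F\<close> need not be integrable, it is clipped at \<open>m - x\<close> and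
  \<open>m + x\<close>. Chebyshev's inequality then concerns the mean of the clipped functional, not
  the median. The clipped values on \<open>F \<le> m\<close> and on \<open>F \<ge> m + x\<close> are
  at least \<open>x\<close> apart, so one of the two events lies at distance at least
  \<open>x / 2\<close> from the mean; a small exceptional probability excludes the event of
  probability at least 1/2. Functions are bounded at every point, not almost everywhere, because the
  kernels evaluate them at individual states.\<close>

definition bounded_measurable :: "'s measure \<Rightarrow> ('s \<Rightarrow> real) \<Rightarrow> bool" where
  "bounded_measurable M h \<longleftrightarrow> h \<in> borel_measurable M \<and> (\<exists>B. \<forall>s\<in>space M. \<bar>h s\<bar> \<le> B)"

lemma bounded_measurableI:
  "h \<in> borel_measurable M \<Longrightarrow> (\<And>s. s \<in> space M \<Longrightarrow> \<bar>h s\<bar> \<le> B) \<Longrightarrow> bounded_measurable M h"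
  by (auto simp: bounded_measurable_def)

lemma bounded_measurableD [measurable_dest]:
  "bounded_measurable M h \<Longrightarrow> h \<in> borel_measurable M"
  by (simp add: bounded_measurable_def)

lemma bounded_measurable_bound:
  assumes "bounded_measurable M h"
  obtains B where "B \<ge> 0" "\<And>s. s \<in> space M \<Longrightarrow> \<bar>h s\<bar> \<le> B"
proof -
  obtain B where "\<forall>s\<in>space M. \<bar>h s\<bar> \<le> B"
    using assms by (auto simp: bounded_measurable_def)
  then show ?thesis
    using that[of "max B 0"] by (simp add: le_max_iff_disj)
qed

lemma bounded_measurable_const [intro, simp]: "bounded_measurable M (\<lambda>_. c)"
  by (rule bounded_measurableI) auto

lemma bounded_measurable_indicator [intro]: "A \<in> sets M \<Longrightarrow> bounded_measurable M (indicator A)"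
  by (rule bounded_measurableI[where B = 1]) (auto split: split_indicator)

lemma bounded_measurable_add [intro]:
  assumes "bounded_measurable M f" "bounded_measurable M g"
  shows "bounded_measurable M (\<lambda>s. f s + g s)"
proof -
  obtain A B where "\<And>s. s \<in> space M \<Longrightarrow> \<bar>f s\<bar> \<le> A" "\<And>s. s \<in> space M \<Longrightarrow> \<bar>g s\<bar> \<le> B"
    using assms by (metis bounded_measurable_bound)
  then show ?thesis
    using assms
    by (intro bounded_measurableI[where B = "A + B"] order_trans[OF abs_triangle_ineq add_mono])
      (auto dest: bounded_measurableD)
qed

lemma bounded_measurable_mult [intro]:
  assumes "bounded_measurable M f" "bounded_measurable M g"
  shows "bounded_measurable M (\<lambda>s. f s * g s)"
proof -
  obtain A B where "A \<ge> 0" "\<And>s. s \<in> space M \<Longrightarrow> \<bar>f s\<bar> \<le> A" "\<And>s. s \<in> space M \<Longrightarrow> \<bar>g s\<bar> \<le> B"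
    using assms by (metis bounded_measurable_bound)
  then show ?thesis
    using assms
    by (intro bounded_measurableI[where B = "A * B"]) (auto dest: bounded_measurableD simp: abs_mult intro: mult_mono)
qed

lemma bounded_measurable_diff [intro]:
  assumes "bounded_measurable M f" "bounded_measurable M g"
  shows "bounded_measurable M (\<lambda>s. f s - g s)"
  using bounded_measurable_add[OF assms(1) bounded_measurable_mult[OF bounded_measurable_const[of M "-1"] assms(2)]]
  by simp

lemma bounded_measurable_power2 [intro]:
  "bounded_measurable M f \<Longrightarrow> bounded_measurable M (\<lambda>s. (f s)\<^sup>2)"
  unfolding power2_eq_square by (rule bounded_measurable_mult)

lemma bounded_measurable_compose:
  assumes "bounded_measurable N f" "g \<in> measurable M N"
  shows "bounded_measurable M (\<lambda>s. f (g s))"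
proof -
  obtain B where "\<And>s. s \<in> space N \<Longrightarrow> \<bar>f s\<bar> \<le> B"
    using assms(1) by (metis bounded_measurable_bound)
  then show ?thesis
    using assms by (intro bounded_measurableI[where B = B])
      (auto dest: bounded_measurableD measurable_space)
qed

lemma bounded_measurable_abs [intro]:
  assumes "bounded_measurable M f"
  shows "bounded_measurable M (\<lambda>s. \<bar>f s\<bar>)"
  using assms unfolding bounded_measurable_def by auto

lemma (in finite_measure) integrable_bounded_measurable [intro]:
  assumes "bounded_measurable M h"
  shows "integrable M h"
proof -
  obtain B where "\<And>s. s \<in> space M \<Longrightarrow> \<bar>h s\<bar> \<le> B"
    using assms by (metis bounded_measurable_bound)
  then show ?thesis
    using bounded_measurableD[OF assms] by (intro integrable_const_bound[where B = B]) auto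
qed

lemma (in prob_space) expectation_square_le:
  assumes "bounded_measurable M h"
  shows "(expectation h)\<^sup>2 \<le> expectation (\<lambda>s. (h s)\<^sup>2)"
proof -
  have "0 \<le> variance h" by (rule variance_positive)
  also have "variance h = expectation (\<lambda>s. (h s)\<^sup>2) - (expectation h)\<^sup>2"
    using assms by (intro variance_eq) auto
  finally show ?thesis by simp
qed

section \<open>Random walks with commuting jumps\<close>

text \<open>The one-step kernel moves \<open>s\<close> to \<open>act y s\<close> with \<open>y\<close> drawn from \<open>M\<close>. Because the moves
  commute, the difference operators \<open>h (act y s) - h s\<close> commute with the kernel.\<close>

locale commuting_jumps = prob_space M for M :: "'y measure" +
  fixes N :: "'s measure" and act :: "'y \<Rightarrow> 's \<Rightarrow> 's"
  assumes act_measurable [measurable]: "(\<lambda>(y, s). act y s) \<in> measurable (M \<Otimes>\<^sub>M N) N"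
    and act_commute: "\<And>y z s. y \<in> space M \<Longrightarrow> z \<in> space M \<Longrightarrow> s \<in> space N \<Longrightarrow>
          act y (act z s) = act z (act y s)"
begin

lemma act_space: "y \<in> space M \<Longrightarrow> s \<in> space N \<Longrightarrow> act y s \<in> space N"
  using measurable_space[OF act_measurable, of "(y, s)"] by (simp add: space_pair_measure)

lemma act_measurable_left [measurable]: "y \<in> space M \<Longrightarrow> act y \<in> measurable N N"
  using measurable_compose[OF measurable_Pair1' act_measurable, of y] by simp

lemma act_measurable_right: "s \<in> space N \<Longrightarrow> (\<lambda>y. act y s) \<in> measurable M N"
  using measurable_compose[OF measurable_Pair2' act_measurable, of s] by simp

definition avg :: "('s \<Rightarrow> real) \<Rightarrow> 's \<Rightarrow> real" where
  "avg h s = (\<integral>y. h (act y s) \<partial>M)"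

text \<open>Twice the carre du champ of the jump generator \<open>avg h - h\<close>.\<close>

definition energy :: "('s \<Rightarrow> real) \<Rightarrow> 's \<Rightarrow> real" where
  "energy h s = (\<integral>y. (h (act y s) - h s)\<^sup>2 \<partial>M)"

lemma bounded_measurable_act:
  "bounded_measurable N h \<Longrightarrow> s \<in> space N \<Longrightarrow> bounded_measurable M (\<lambda>y. h (act y s))"
  by (rule bounded_measurable_compose[OF _ act_measurable_right])

lemma bounded_measurable_integral:
  assumes "bounded_measurable (N \<Otimes>\<^sub>M M) (\<lambda>(s, y). k s y)"
  shows "bounded_measurable N (\<lambda>s. \<integral>y. k s y \<partial>M)"
proof -
  obtain B where B: "\<And>z. z \<in> space (N \<Otimes>\<^sub>M M) \<Longrightarrow> \<bar>case z of (s, y) \<Rightarrow> k s y\<bar> \<le> B"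
    using assms by (metis bounded_measurable_bound)
  have [measurable]: "(\<lambda>(s, y). k s y) \<in> borel_measurable (N \<Otimes>\<^sub>M M)"
    using assms by (rule bounded_measurableD)
  show ?thesis
  proof (rule bounded_measurableI[where B = B])
    fix s assume s: "s \<in> space N"
    have "\<bar>k s y\<bar> \<le> B" if "y \<in> space M" for y
      using B[of "(s, y)"] s that by (simp add: space_pair_measure)
    moreover have "(\<lambda>y. k s y) \<in> borel_measurable M"
      using s by measurable
    ultimately have "(\<integral>y. \<bar>k s y\<bar> \<partial>M) \<le> (\<integral>y. B \<partial>M)"
      by (auto simp del: lebesgue_integral_const intro!: integral_mono integrable_const_bound[where B = B])
    then show "\<bar>\<integral>y. k s y \<partial>M\<bar> \<le> B"
      by (intro order_trans[OF integral_abs_bound]) (simp add: prob_space)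
  qed measurable
qed

lemma bounded_measurable_act_pair:
  assumes "bounded_measurable N h"
  shows "bounded_measurable (N \<Otimes>\<^sub>M M) (\<lambda>(s, y). h (act y s))"
proof -
  have "(\<lambda>(s, y). act y s) \<in> measurable (N \<Otimes>\<^sub>M M) N" by measurable
  from bounded_measurable_compose[OF assms this] show ?thesis by (simp add: case_prod_beta')
qed

lemma bounded_measurable_fst_pair:
  assumes "bounded_measurable N h"
  shows "bounded_measurable (N \<Otimes>\<^sub>M M) (\<lambda>(s, y). h s)"
  using bounded_measurable_compose[OF assms measurable_fst] by (simp add: case_prod_beta')

lemma bounded_measurable_difference:
  assumes "bounded_measurable N h"
  shows "bounded_measurable (N \<Otimes>\<^sub>M M) (\<lambda>(s, y). h (act y s) - h s)"
  using bounded_measurable_diff[OF bounded_measurable_act_pair[OF assms] bounded_measurable_fst_pair[OF assms]]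
  by (simp add: case_prod_beta')

lemma bounded_measurable_avg [intro]: "bounded_measurable N h \<Longrightarrow> bounded_measurable N (avg h)"
  unfolding avg_def by (rule bounded_measurable_integral[OF bounded_measurable_act_pair])

lemma bounded_measurable_energy [intro]:
  "bounded_measurable N h \<Longrightarrow> bounded_measurable N (energy h)"
  unfolding energy_def
  using bounded_measurable_power2[OF bounded_measurable_difference, of h]
  by (intro bounded_measurable_integral) (simp add: case_prod_beta')

lemma energy_nonneg: "0 \<le> energy h s"
  by (simp add: energy_def)

lemma avg_mono:
  assumes "bounded_measurable N f" "bounded_measurable N g" "\<And>s. s \<in> space N \<Longrightarrow> f s \<le> g s" "s \<in> space N"
  shows "avg f s \<le> avg g s"
  unfolding avg_def using assms
  by (intro integral_mono integrable_bounded_measurable bounded_measurable_act) (auto intro: act_space)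

lemma avg_lin:
  assumes "bounded_measurable N f" "bounded_measurable N g" "s \<in> space N"
  shows "avg (\<lambda>s. a * f s + b * g s) s = a * avg f s + b * avg g s"
  unfolding avg_def using assms bounded_measurable_act
  by (subst Bochner_Integration.integral_add) auto

lemma bounded_measurable_funpow:
  assumes "\<And>h. bounded_measurable N h \<Longrightarrow> bounded_measurable N (T h)" "bounded_measurable N h"
  shows "bounded_measurable N ((T ^^ n) h)"
  using assms by (induction n) auto

lemma bounded_measurable_avg_pow [intro]:
  "bounded_measurable N h \<Longrightarrow> bounded_measurable N ((avg ^^ n) h)"
  by (rule bounded_measurable_funpow[OF bounded_measurable_avg])

lemma avg_pow_mono:
  assumes "bounded_measurable N f" "bounded_measurable N g" "\<And>s. s \<in> space N \<Longrightarrow> f s \<le> g s" "s \<in> space N"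
  shows "(avg ^^ n) f s \<le> (avg ^^ n) g s"
  using assms(4) by (induction n arbitrary: s) (auto intro!: avg_mono assms)

lemma avg_pow_lin:
  assumes f: "bounded_measurable N f" and g: "bounded_measurable N g" and "s \<in> space N"
  shows "(avg ^^ n) (\<lambda>s. a * f s + b * g s) s = a * (avg ^^ n) f s + b * (avg ^^ n) g s"
  using assms(3)
proof (induction n arbitrary: s)
  case (Suc n)
  have "avg ((avg ^^ n) (\<lambda>s. a * f s + b * g s)) s = avg (\<lambda>s. a * (avg ^^ n) f s + b * (avg ^^ n) g s) s"
    unfolding avg_def[of _ s] using Suc by (intro Bochner_Integration.integral_cong) (auto simp: act_space)
  also have "\<dots> = a * avg ((avg ^^ n) f) s + b * avg ((avg ^^ n) g) s"
    using Suc f g by (intro avg_lin) auto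
  finally show ?case by simp
qed simp

lemma avg_const: "avg (\<lambda>_. c) = (\<lambda>_. c)"
  by (simp add: avg_def prob_space fun_eq_iff)

lemma avg_pow_const: "(avg ^^ n) (\<lambda>_. c) = (\<lambda>_. c)"
  by (induction n) (simp_all add: avg_const)

lemma avg_pow_abs_le:
  assumes "bounded_measurable N h" "\<And>s. s \<in> space N \<Longrightarrow> \<bar>h s\<bar> \<le> B" "s \<in> space N"
  shows "\<bar>(avg ^^ n) h s\<bar> \<le> B"
proof -
  have "(avg ^^ n) h s \<le> (avg ^^ n) (\<lambda>_. B) s" "(avg ^^ n) (\<lambda>_. - B) s \<le> (avg ^^ n) h s"
    using assms by (auto intro!: avg_pow_mono simp: abs_le_iff minus_le_iff)
  then show ?thesis by (simp add: avg_pow_const)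
qed

text \<open>One Bernoulli step. Taking \<open>n\<close> steps with \<open>p = l / n\<close>
  discretises the semigroup with generator \<open>l * (avg h - h)\<close>, whose number of jumps is
  Poisson.\<close>

definition lazy :: "real \<Rightarrow> ('s \<Rightarrow> real) \<Rightarrow> 's \<Rightarrow> real" where
  "lazy p h s = (1 - p) * h s + p * avg h s"

context
  fixes p :: real assumes p: "0 \<le> p" "p \<le> 1"
begin

lemma bounded_measurable_lazy [intro]:
  "bounded_measurable N h \<Longrightarrow> bounded_measurable N (lazy p h)"
  unfolding lazy_def by (intro bounded_measurable_add bounded_measurable_mult) auto

text \<open>Powers of \<open>(1 - p) * id + p * avg\<close> expand binomially. Besides preparing the
  Poisson limit, this transfers monotonicity and linearity from the powers of \<open>avg\<close> to
  those of \<open>lazy p\<close>.\<close>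

lemma lazy_pow_eq_binomial:
  assumes "bounded_measurable N h" "s \<in> space N"
  shows "(lazy p ^^ n) h s = measure_pmf.expectation (binomial_pmf n p) (\<lambda>k. (avg ^^ k) h s)"
  using assms
proof (induction n arbitrary: h)
  case 0
  then show ?case using p by (simp add: binomial_pmf_0)
next
  case (Suc n)
  let ?a = "\<lambda>k. (avg ^^ k) h s"
  have "(lazy p ^^ Suc n) h s = (lazy p ^^ n) (lazy p h) s"
    by (simp add: funpow_swap1)
  also have "\<dots> = measure_pmf.expectation (binomial_pmf n p) (\<lambda>k. (avg ^^ k) (lazy p h) s)"
    using Suc by auto
  also have "\<dots> = measure_pmf.expectation (binomial_pmf n p) (\<lambda>k. (1 - p) * ?a k + p * ?a (Suc k))"
    unfolding lazy_def using Suc.prems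
    by (intro Bochner_Integration.integral_cong refl, subst avg_pow_lin)
      (auto simp: funpow_swap1)
  also have "\<dots> = (1 - p) * measure_pmf.expectation (binomial_pmf n p) ?a
      + p * measure_pmf.expectation (binomial_pmf n p) (\<lambda>k. ?a (Suc k))"
    using p by (subst Bochner_Integration.integral_add) auto
  also have "\<dots> = measure_pmf.expectation (binomial_pmf (Suc n) p) ?a"
  proof -
    \<comment> \<open>The expectation of the bind unfolds into a finite sum because the Bernoulli
      choice and, for each outcome, the shifted binomial law have finite support.\<close>
    have *: "set_pmf (binomial_pmf n p \<bind> (\<lambda>k. return_pmf ((if b then 1 else 0) + k)))
        \<subseteq> (\<lambda>k. (if b then 1 else 0) + k) ` {..n}" for b
      using p by (auto simp: set_pmf_binomial_eq)
    have **: "finite (set_pmf (binomial_pmf n p \<bind> (\<lambda>k. return_pmf ((if b then 1 else 0) + k))))" for b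
      by (rule finite_subset[OF *]) simp
    have "binomial_pmf n p \<bind> (\<lambda>k. return_pmf (c + k)) = map_pmf (\<lambda>k. c + k) (binomial_pmf n p)" for c
      by (simp add: map_pmf_def)
    then show ?thesis
      using p ** by (subst binomial_pmf_Suc, simp, subst pmf_expectation_bind[where A = UNIV])
        (auto simp: UNIV_bool)
  qed
  finally show ?case .
qed

lemma lazy_pow_mono:
  assumes "bounded_measurable N f" "bounded_measurable N g" "\<And>s. s \<in> space N \<Longrightarrow> f s \<le> g s" "s \<in> space N"
  shows "(lazy p ^^ n) f s \<le> (lazy p ^^ n) g s"
  using assms p by (auto simp: lazy_pow_eq_binomial intro!: integral_mono avg_pow_mono)

lemma lazy_pow_lin:
  assumes "bounded_measurable N f" "bounded_measurable N g" "s \<in> space N"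
  shows "(lazy p ^^ n) (\<lambda>s. a * f s + b * g s) s = a * (lazy p ^^ n) f s + b * (lazy p ^^ n) g s"
proof -
  have "bounded_measurable N (\<lambda>s. a * f s + b * g s)"
    using assms by (intro bounded_measurable_add bounded_measurable_mult) auto
  then show ?thesis
    using assms p by (simp add: lazy_pow_eq_binomial avg_pow_lin)
qed

text \<open>Measured from \<open>h s\<close>, the increment over one step has second moment
  \<open>p * energy h s\<close> and mean \<open>p\<close> times the average difference; discarding
  the squared mean gives the bound.\<close>

lemma lazy_variance_le:
  assumes "bounded_measurable N h" "s \<in> space N"
  shows "lazy p (\<lambda>s. (h s)\<^sup>2) s - (lazy p h s)\<^sup>2 \<le> p * energy h s"
proof -
  let ?D = "\<lambda>y. h (act y s) - h s"
  have D: "bounded_measurable M ?D"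
    using bounded_measurable_act[OF assms] by auto
  then have D2: "bounded_measurable M (\<lambda>y. (?D y)\<^sup>2)" by auto
  have "avg h s = (\<integral>y. ?D y + h s \<partial>M)" by (simp add: avg_def)
  also have "\<dots> = expectation ?D + h s"
    using D by (subst Bochner_Integration.integral_add) (auto simp: prob_space)
  finally have 1: "avg h s = expectation ?D + h s" .
  have "avg (\<lambda>s. (h s)\<^sup>2) s = (\<integral>y. (?D y)\<^sup>2 + (2 * h s * ?D y + (h s)\<^sup>2) \<partial>M)"
    by (simp add: avg_def power2_eq_square algebra_simps)
  also have "\<dots> = energy h s + (2 * h s * expectation ?D + (h s)\<^sup>2)"
    unfolding energy_def using integrable_bounded_measurable[OF D] integrable_bounded_measurable[OF D2]
    by (simp add: prob_space del: Bochner_Integration.integral_diff)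
  finally have 2: "avg (\<lambda>s. (h s)\<^sup>2) s = energy h s + (2 * h s * expectation ?D + (h s)\<^sup>2)" .
  have "lazy p (\<lambda>s. (h s)\<^sup>2) s - (lazy p h s)\<^sup>2 = p * energy h s - p\<^sup>2 * (expectation ?D)\<^sup>2"
    unfolding lazy_def 1 2 by (simp add: algebra_simps power2_eq_square)
  also have "\<dots> \<le> p * energy h s" by simp
  finally show ?thesis .
qed

text \<open>Contraction of gradients. Since moves commute, the difference of \<open>lazy p h\<close>
  under a move is the lazy average of the differences of \<open>h\<close>. Convexity of the square
  for the Bernoulli choice, Jensen's inequality for the jump and Fubini give the rest.\<close>

lemma energy_lazy_le:
  assumes h: "bounded_measurable N h" and s: "s \<in> space N"
  shows "energy (lazy p h) s \<le> lazy p (energy h) s"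
proof -
  interpret MM: pair_prob_space M M ..
  let ?D = "\<lambda>y s. h (act y s) - h s"
  have DD: "bounded_measurable (M \<Otimes>\<^sub>M M) (\<lambda>(z, y). (?D y (act z s))\<^sup>2)"
  proof -
    have "(\<lambda>(z, y). (act z s, y)) \<in> measurable (M \<Otimes>\<^sub>M M) (N \<Otimes>\<^sub>M M)"
      using s act_measurable_right[OF s] by measurable
    from bounded_measurable_compose[OF bounded_measurable_power2[OF bounded_measurable_difference[OF h]] this]
    show ?thesis by (simp add: case_prod_beta')
  qed
  have DD': "bounded_measurable (M \<Otimes>\<^sub>M M) (\<lambda>(y, z). (?D y (act z s))\<^sup>2)"
    using bounded_measurable_compose[OF DD measurable_pair_swap'] by (simp add: case_prod_beta')
  have "bounded_measurable M (\<lambda>z. (?D y (act z s))\<^sup>2)" if "y \<in> space M" for y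
    using bounded_measurable_compose[OF DD' measurable_Pair1'[OF that]] by simp
  have inner: "bounded_measurable M (\<lambda>y. \<integral>z. (?D y (act z s))\<^sup>2 \<partial>M)"
  proof -
    \<comment> \<open>A degenerate instance whose states are the points of \<open>M\<close> and
      whose moves do nothing; its purpose is the measurability of an integral with a parameter in
      \<open>M\<close>.\<close>
    interpret M': commuting_jumps M M "\<lambda>y z. z" by unfold_locales auto
    show ?thesis using M'.bounded_measurable_integral[OF DD'] by simp
  qed
  have D: "bounded_measurable M (\<lambda>y. ?D y s)"
    using bounded_measurable_act[OF h s] by auto
  have pw: "(lazy p h (act y s) - lazy p h s)\<^sup>2
      \<le> (1 - p) * (?D y s)\<^sup>2 + p * (\<integral>z. (?D y (act z s))\<^sup>2 \<partial>M)" if y: "y \<in> space M" for y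
  proof -
    have Dy: "bounded_measurable M (\<lambda>z. ?D y (act z s))"
      using bounded_measurable_act[OF bounded_measurable_compose[OF h act_measurable_left[OF y]] s]
        bounded_measurable_act[OF h s] by auto
    have "avg h (act y s) = (\<integral>z. h (act y (act z s)) \<partial>M)"
      unfolding avg_def by (intro Bochner_Integration.integral_cong) (auto simp: act_commute y s)
    then have "avg h (act y s) - avg h s = expectation (\<lambda>z. ?D y (act z s))"
      unfolding avg_def
      using bounded_measurable_act[OF bounded_measurable_compose[OF h act_measurable_left[OF y]] s]
        bounded_measurable_act[OF h s] by (subst Bochner_Integration.integral_diff) auto
    then have "lazy p h (act y s) - lazy p h s = (1 - p) * ?D y s + p * expectation (\<lambda>z. ?D y (act z s))"
      by (simp add: lazy_def algebra_simps)
    also have "((1 - p) * ?D y s + p * expectation (\<lambda>z. ?D y (act z s)))\<^sup>2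
        \<le> (1 - p) * (?D y s)\<^sup>2 + p * (expectation (\<lambda>z. ?D y (act z s)))\<^sup>2"
      using convex_onD[OF convex_power2, of p "?D y s" "expectation (\<lambda>z. ?D y (act z s))"] p by simp
    also have "\<dots> \<le> (1 - p) * (?D y s)\<^sup>2 + p * (\<integral>z. (?D y (act z s))\<^sup>2 \<partial>M)"
      using expectation_square_le[OF Dy] p by (intro add_mono mult_left_mono) auto
    finally show ?thesis .
  qed
  have "energy (lazy p h) s \<le> (\<integral>y. (1 - p) * (?D y s)\<^sup>2 + p * (\<integral>z. (?D y (act z s))\<^sup>2 \<partial>M) \<partial>M)"
    unfolding energy_def using pw
    by (intro integral_mono integrable_bounded_measurable bounded_measurable_power2 bounded_measurable_add
        bounded_measurable_mult bounded_measurable_const D inner bounded_measurable_diff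
        bounded_measurable_act[OF bounded_measurable_lazy[OF h] s]) auto
  also have "\<dots> = (1 - p) * energy h s + p * (\<integral>y. (\<integral>z. (?D y (act z s))\<^sup>2 \<partial>M) \<partial>M)"
    unfolding energy_def using bounded_measurable_power2[OF D] inner
    by (subst Bochner_Integration.integral_add) auto
  also have "(\<integral>y. (\<integral>z. (?D y (act z s))\<^sup>2 \<partial>M) \<partial>M) = (\<integral>z. (\<integral>y. (?D y (act z s))\<^sup>2 \<partial>M) \<partial>M)"
    using MM.integrable_bounded_measurable[OF DD]
    by (intro MM.Fubini_integral) simp
  finally show ?thesis by (simp add: lazy_def avg_def energy_def)
qed

text \<open>Peeling off one step splits the variance: that step contributes
  \<open>p * energy h\<close>, averaged over the others, and the rest is the induction hypothesis
  for \<open>lazy p h\<close>, whose energy is controlled by contraction. The energy ends up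
  averaged over one step fewer than the variance.\<close>

lemma lazy_pow_variance_le:
  assumes "bounded_measurable N h" "s \<in> space N"
  shows "(lazy p ^^ Suc n) (\<lambda>s. (h s)\<^sup>2) s - ((lazy p ^^ Suc n) h s)\<^sup>2
      \<le> Suc n * p * (lazy p ^^ n) (energy h) s"
  using assms
proof (induction n arbitrary: h)
  case 0
  then show ?case using lazy_variance_le by simp
next
  case (Suc n)
  note h = Suc.prems(1) and s = Suc.prems(2)
  let ?T = "lazy p" and ?U = "lazy p ^^ Suc n"
  have U: "(?T ^^ Suc (Suc n)) f = ?U (?T f)" for f
    by (simp only: funpow_Suc_right o_def)
  have T2: "bounded_measurable N (\<lambda>s. (?T h s)\<^sup>2)" "bounded_measurable N (?T (\<lambda>s. (h s)\<^sup>2))"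
    using h by auto
  have "?U (?T (\<lambda>s. (h s)\<^sup>2)) s - ?U (\<lambda>s. (?T h s)\<^sup>2) s
      = ?U (\<lambda>s. 1 * ?T (\<lambda>s. (h s)\<^sup>2) s + (- 1) * (?T h s)\<^sup>2) s"
    using T2 s by (subst lazy_pow_lin) auto
  also have "\<dots> \<le> ?U (\<lambda>s. p * energy h s + 0 * 0) s"
    using lazy_variance_le[OF h] h s T2
    by (intro lazy_pow_mono bounded_measurable_add bounded_measurable_mult) (auto)
  also have "\<dots> = p * ?U (energy h) s"
    using h s by (subst lazy_pow_lin) auto
  finally have 1: "?U (?T (\<lambda>s. (h s)\<^sup>2)) s - ?U (\<lambda>s. (?T h s)\<^sup>2) s \<le> p * ?U (energy h) s" .
  have "?U (\<lambda>s. (?T h s)\<^sup>2) s - (?U (?T h) s)\<^sup>2 \<le> Suc n * p * (?T ^^ n) (energy (?T h)) s"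
    using h s by (intro Suc.IH) auto
  also have "\<dots> \<le> Suc n * p * (?T ^^ n) (?T (energy h)) s"
    using h s p energy_lazy_le by (intro mult_left_mono lazy_pow_mono) auto
  also have "(?T ^^ n) (?T (energy h)) = ?U (energy h)"
    by (simp only: funpow_Suc_right o_def)
  finally show ?case
    using 1 unfolding U by (simp add: algebra_simps)
qed

end

end

section \<open>Poisson number of jumps\<close>

text \<open>Rate 0 is included as the point mass at 0, since the set to be resampled may have
  intensity zero.\<close>

definition poisson_pmf0 :: "real \<Rightarrow> nat pmf" where
  "poisson_pmf0 l = (if l = 0 then return_pmf 0 else poisson_pmf l)"

lemma pmf_poisson_pmf0: "0 \<le> l \<Longrightarrow> pmf (poisson_pmf0 l) k = l ^ k / fact k * exp (- l)"
  by (cases "k = 0") (auto simp: poisson_pmf0_def)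

lemma expectation_poisson_pmf0:
  fixes a :: "nat \<Rightarrow> real"
  assumes "0 \<le> l" "\<And>k. \<bar>a k\<bar> \<le> B"
  shows "measure_pmf.expectation (poisson_pmf0 l) a = (\<Sum>k. l ^ k / fact k * exp (- l) * a k)"
proof -
  have "measure_pmf.expectation (poisson_pmf0 l) a
      = (\<integral>k. l ^ k / fact k * exp (- l) * a k \<partial>count_space UNIV)"
    unfolding measure_pmf_eq_density using assms
    by (subst integral_density) (auto simp: pmf_poisson_pmf0)
  also have "\<dots> = (\<Sum>k. l ^ k / fact k * exp (- l) * a k)"
  proof (intro integral_count_space_nat)
    have "integrable (measure_pmf (poisson_pmf0 l)) a"
      using assms by (intro measure_pmf.integrable_const_bound[where B = B]) auto
    then show "integrable (count_space UNIV) (\<lambda>k. l ^ k / fact k * exp (- l) * a k)"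
      unfolding measure_pmf_eq_density using assms
      by (subst (asm) integrable_density) (auto simp: pmf_poisson_pmf0)
  qed
  finally show ?thesis .
qed

lemma binomial_weights_tendsto:
  fixes l :: real
  shows "(\<lambda>n. real (n choose k) * (l / n) ^ k * (1 - l / n) ^ (n - k)) \<longlonglongrightarrow> l ^ k / fact k * exp (- l)"
\<comment> \<open>With \<open>n + k\<close> in place of \<open>n\<close> the truncated subtraction
  disappears. The binomial coefficient over \<open>n ^ k\<close> tends to \<open>1 / fact k\<close>,
  the full power to \<open>exp (- l)\<close>, and the factors with fixed exponent \<open>k\<close>
  to 1.\<close>
proof (rule LIMSEQ_offset[where k = k])
  have 1: "(\<lambda>n. real ((k + n) choose n) / real (n ^ k)) \<longlonglongrightarrow> 1 / fact k"
    by (rule fact_binomial_limit)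
  have 2: "(\<lambda>n. (1 + (- l) / real (n + k)) ^ (n + k)) \<longlonglongrightarrow> exp (- l)"
    using LIMSEQ_ignore_initial_segment[OF tendsto_exp_limit_sequentially] .
  have "(\<lambda>n. l / real (n + k)) \<longlonglongrightarrow> 0"
    using LIMSEQ_ignore_initial_segment[OF lim_const_over_n[of l], of k] by simp
  then have 3: "(\<lambda>n. (1 - l / real (n + k)) ^ k) \<longlonglongrightarrow> (1 - 0) ^ k"
    by (intro tendsto_intros)
  have "(\<lambda>n. real k / real (n + k)) \<longlonglongrightarrow> 0"
    using LIMSEQ_ignore_initial_segment[OF lim_const_over_n[of "real k"], of k] by simp
  then have 4: "(\<lambda>n. (1 - real k / real (n + k)) ^ k) \<longlonglongrightarrow> (1 - 0) ^ k"
    by (intro tendsto_intros)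
  have "(\<lambda>n. real ((k + n) choose n) / real (n ^ k) * l ^ k * (1 - real k / real (n + k)) ^ k
      * ((1 + (- l) / real (n + k)) ^ (n + k) / (1 - l / real (n + k)) ^ k))
      \<longlonglongrightarrow> 1 / fact k * l ^ k * (1 - 0) ^ k * (exp (- l) / (1 - 0) ^ k)"
    by (intro tendsto_intros 1 2 3 4) simp
  then have "(\<lambda>n. real ((k + n) choose n) / real (n ^ k) * l ^ k * (1 - real k / real (n + k)) ^ k
      * ((1 + (- l) / real (n + k)) ^ (n + k) / (1 - l / real (n + k)) ^ k))
      \<longlonglongrightarrow> l ^ k / fact k * exp (- l)" by simp
  moreover have "\<forall>\<^sub>F n in sequentially. real ((k + n) choose n) / real (n ^ k) * l ^ k * (1 - real k / real (n + k)) ^ k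
      * ((1 + (- l) / real (n + k)) ^ (n + k) / (1 - l / real (n + k)) ^ k)
    = real ((n + k) choose k) * (l / (n + k)) ^ k * (1 - l / (n + k)) ^ (n + k - k)"
    \<comment> \<open>\<open>n > \<bar>l\<bar>\<close> makes \<open>1 - l / (n + k)\<close> nonzero,
      so that the surplus \<open>k\<close> factors of the full power cancel.\<close>
    using eventually_gt_at_top[of "nat \<lceil>\<bar>l\<bar>\<rceil>"] eventually_gt_at_top[of 0]
  proof eventually_elim
    case (elim n)
    then have n: "0 < real n" "l < real (n + k)" by linarith+
    then have ne: "1 - l / real (n + k) \<noteq> 0" by (simp add: field_simps)
    have "(1 + (- l) / real (n + k)) ^ (n + k) / (1 - l / real (n + k)) ^ k = (1 - l / real (n + k)) ^ n"
      unfolding power_add using power_not_zero[OF ne, of k] by simp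
    moreover have "1 - real k / real (n + k) = real n / real (n + k)"
      using n by (simp add: field_simps)
    moreover have "(k + n) choose n = (n + k) choose k"
      using binomial_symmetric[of n "k + n"] by (simp add: add.commute)
    ultimately show ?case
      using n by (simp add: power_divide)
  qed
  ultimately show "(\<lambda>n. real ((n + k) choose k) * (l / (n + k)) ^ k * (1 - l / (n + k)) ^ (n + k - k))
      \<longlonglongrightarrow> l ^ k / fact k * exp (- l)"
    by (rule Lim_transform_eventually)
qed

text \<open>Tannery's theorem, that is, dominated convergence for series:
  \<open>(n choose k) * fact k \<le> n ^ k\<close> bounds the weights by
  \<open>l ^ k / fact k\<close>, uniformly in \<open>n > l\<close>.\<close>

lemma binomial_tendsto_poisson:
  fixes a :: "nat \<Rightarrow> real"
  assumes l: "0 \<le> l" and B: "\<And>k. \<bar>a k\<bar> \<le> B"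
  shows "(\<lambda>n. measure_pmf.expectation (binomial_pmf n (l / n)) a)
    \<longlonglongrightarrow> measure_pmf.expectation (poisson_pmf0 l) a"
proof -
  have ev: "\<forall>\<^sub>F n in sequentially. l < real n"
    by (rule eventually_mono[OF eventually_gt_at_top[of "nat \<lceil>l\<rceil>"]]) linarith
  define w where "w = (\<lambda>k n. real (n choose k) * (l / n) ^ k * (1 - l / n) ^ (n - k) * a k)"
  have "((\<lambda>n. \<Sum>k. w k n) \<longlongrightarrow> (\<Sum>k. l ^ k / fact k * exp (- l) * a k)) sequentially"
  proof (rule tannerys_theorem[THEN conjunct2, THEN conjunct2])
    show "(\<lambda>n. w k n) \<longlonglongrightarrow> l ^ k / fact k * exp (- l) * a k" for k
      unfolding w_def by (intro tendsto_mult binomial_weights_tendsto tendsto_const)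
    show "summable (\<lambda>k. l ^ k / fact k * B)"
      using summable_mult2[OF summable_exp[of l], of B] by (simp add: field_simps)
    have "norm (w k n) \<le> l ^ k / fact k * B" if "l < real n" for k n
    proof -
      have n: "0 < real n" using l that by linarith
      have "real (n choose k) * (l / n) ^ k * (1 - l / n) ^ (n - k) \<le> real (n choose k) * (l / n) ^ k"
        using l that n by (intro mult_right_le_one_le power_le_one) (auto simp: field_simps)
      also have "\<dots> \<le> l ^ k / fact k"
      proof -
        have "real (n choose k) * fact k \<le> real n ^ k"
          using binomial_fact_pow[of n k] by (metis of_nat_fact of_nat_le_iff of_nat_mult of_nat_power)
        then have "real (n choose k) \<le> real n ^ k / fact k"
          by (simp add: field_simps)
        then have "real (n choose k) * (l / n) ^ k \<le> real n ^ k / fact k * (l / n) ^ k"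
          using l by (intro mult_right_mono) auto
        then show ?thesis using n by (simp add: power_divide)
      qed
      finally have "real (n choose k) * (l / n) ^ k * (1 - l / n) ^ (n - k) \<le> l ^ k / fact k" .
      moreover have "0 \<le> 1 - l / n" using that n by (simp add: field_simps)
      ultimately show ?thesis
        unfolding w_def real_norm_def abs_mult using l n
        by (intro mult_mono B) (auto simp: abs_mult)
    qed
    then show "\<forall>\<^sub>F (k, n) in at_top \<times>\<^sub>F sequentially. norm (w k n) \<le> l ^ k / fact k * B"
      unfolding eventually_prod_filter using ev
      by (intro exI[of _ "\<lambda>_. True"] exI[of _ "\<lambda>n. l < real n"]) auto
  qed auto
  moreover have "\<forall>\<^sub>F n in sequentially. (\<Sum>k. w k n) = measure_pmf.expectation (binomial_pmf n (l / n)) a"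
    using ev
  proof eventually_elim
    case (elim n)
    then have "l / n \<in> {0..1}" using l by (auto simp: field_simps)
    then show ?case
      unfolding w_def by (subst suminf_finite[of "{..n}"]) (auto simp: expectation_binomial_pmf' binomial_eq_0)
  qed
  ultimately show ?thesis
    unfolding expectation_poisson_pmf0[OF assms] by (rule Lim_transform_eventually)
qed

section \<open>Variance inequality for the compound Poisson semigroup\<close>

context commuting_jumps
begin

text \<open>The compound Poisson semigroup \<open>exp (l * (avg - 1))\<close>, written as a mixture
  over the number of jumps.\<close>

definition poisson_avg :: "real \<Rightarrow> ('s \<Rightarrow> real) \<Rightarrow> 's \<Rightarrow> real" where
  "poisson_avg l h s = measure_pmf.expectation (poisson_pmf0 l) (\<lambda>k. (avg ^^ k) h s)"

lemma integrable_avg_pow: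
  assumes "bounded_measurable N h" "s \<in> space N"
  shows "integrable (measure_pmf p) (\<lambda>k. (avg ^^ k) h s)"
proof -
  obtain B where "\<And>s. s \<in> space N \<Longrightarrow> \<bar>h s\<bar> \<le> B"
    using assms(1) by (metis bounded_measurable_bound)
  then show ?thesis
    using avg_pow_abs_le[OF assms(1) _ assms(2)]
    by (intro measure_pmf.integrable_const_bound[where B = B]) auto
qed

lemma poisson_avg_mono:
  assumes "bounded_measurable N f" "bounded_measurable N g" "\<And>s. s \<in> space N \<Longrightarrow> f s \<le> g s" "s \<in> space N"
  shows "poisson_avg l f s \<le> poisson_avg l g s"
  unfolding poisson_avg_def using assms by (intro integral_mono integrable_avg_pow avg_pow_mono) auto

lemma poisson_avg_lin:
  assumes "bounded_measurable N f" "bounded_measurable N g" "s \<in> space N"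
  shows "poisson_avg l (\<lambda>s. a * f s + b * g s) s = a * poisson_avg l f s + b * poisson_avg l g s"
  unfolding poisson_avg_def using assms integrable_avg_pow
  by (subst avg_pow_lin) (auto simp: Bochner_Integration.integral_add)

lemma poisson_avg_const: "poisson_avg l (\<lambda>_. c) s = c"
  by (simp add: poisson_avg_def avg_pow_const)

lemma lazy_pow_tendsto:
  assumes "0 \<le> l" "bounded_measurable N h" "s \<in> space N"
  shows "(\<lambda>n. (lazy (l / n) ^^ n) h s) \<longlonglongrightarrow> poisson_avg l h s"
proof -
  obtain B where B: "\<And>s. s \<in> space N \<Longrightarrow> \<bar>h s\<bar> \<le> B"
    using assms(2) by (metis bounded_measurable_bound)
  have "(\<lambda>n. measure_pmf.expectation (binomial_pmf n (l / n)) (\<lambda>k. (avg ^^ k) h s)) \<longlonglongrightarrow> poisson_avg l h s"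
    unfolding poisson_avg_def
    using avg_pow_abs_le[OF assms(2) B assms(3)] assms(1) by (intro binomial_tendsto_poisson) auto
  moreover have "\<forall>\<^sub>F n in sequentially. measure_pmf.expectation (binomial_pmf n (l / n)) (\<lambda>k. (avg ^^ k) h s)
      = (lazy (l / n) ^^ n) h s"
    using eventually_gt_at_top[of "nat \<lceil>l\<rceil>"]
  proof eventually_elim
    case (elim n)
    then have "l < real n" by linarith
    then show ?case using assms by (subst lazy_pow_eq_binomial) auto
  qed
  ultimately show ?thesis by (rule Lim_transform_eventually)
qed

theorem poisson_variance_le:
  assumes l: "0 \<le> l" and h: "bounded_measurable N h" and s: "s \<in> space N"
  shows "poisson_avg l (\<lambda>s. (h s)\<^sup>2) s - (poisson_avg l h s)\<^sup>2 \<le> l * poisson_avg l (energy h) s"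
proof (rule LIMSEQ_le)
  let ?T = "\<lambda>n :: nat. lazy (l / n) ^^ n"
  show "(\<lambda>n. ?T n (\<lambda>s. (h s)\<^sup>2) s - (?T n h s)\<^sup>2) \<longlonglongrightarrow> poisson_avg l (\<lambda>s. (h s)\<^sup>2) s - (poisson_avg l h s)\<^sup>2"
    using h s l by (intro tendsto_intros lazy_pow_tendsto) auto
  \<comment> \<open>The factor \<open>1 / (1 - l / n)\<close> makes up for the missing step: a lazy
    step stays put with probability \<open>1 - p\<close>, so for the nonnegative energy the average
    over \<open>n - 1\<close> steps is at most that over \<open>n\<close> steps divided by
    \<open>1 - p\<close>.\<close>
  have "(\<lambda>n. l / (1 - l / n) * ?T n (energy h) s) \<longlonglongrightarrow> l / (1 - 0) * poisson_avg l (energy h) s"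
    using h s l by (intro tendsto_intros lazy_pow_tendsto lim_const_over_n) auto
  then show "(\<lambda>n. l / (1 - l / n) * ?T n (energy h) s) \<longlonglongrightarrow> l * poisson_avg l (energy h) s"
    by simp
  have "?T n (\<lambda>s. (h s)\<^sup>2) s - (?T n h s)\<^sup>2 \<le> l / (1 - l / n) * ?T n (energy h) s"
    if n: "n > nat \<lceil>l\<rceil>" for n :: nat
  proof -
    define p where "p = l / n"
    have ln: "l < real n" "0 < real n" using n l by linarith+
    then have p: "0 \<le> p" "p < 1" "n * p = l" using l by (auto simp: p_def field_simps)
    obtain m where m: "n = Suc m" using n by (cases n) auto
    have E: "bounded_measurable N (energy h)" using h by auto
    have "(1 - p) * (lazy p ^^ m) (energy h) s = (lazy p ^^ m) (\<lambda>s. (1 - p) * energy h s + 0 * 0) s"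
      using p E s by (subst lazy_pow_lin) auto
    also have "\<dots> \<le> (lazy p ^^ m) (lazy p (energy h)) s"
    proof (rule lazy_pow_mono)
      show "(1 - p) * energy h s + 0 * 0 \<le> lazy p (energy h) s" if "s \<in> space N" for s
        unfolding lazy_def avg_def using p by (simp add: energy_nonneg)
    qed (use p E s in auto)
    also have "(lazy p ^^ m) (lazy p (energy h)) = (lazy p ^^ n) (energy h)"
      unfolding m by (simp only: funpow_Suc_right o_def)
    finally have "(1 - p) * (lazy p ^^ m) (energy h) s \<le> (lazy p ^^ n) (energy h) s" .
    then have *: "(lazy p ^^ m) (energy h) s \<le> (lazy p ^^ n) (energy h) s / (1 - p)"
      using p by (simp add: field_simps)
    have "(lazy p ^^ n) (\<lambda>s. (h s)\<^sup>2) s - ((lazy p ^^ n) h s)\<^sup>2 \<le> n * p * (lazy p ^^ m) (energy h) s"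
      using lazy_pow_variance_le[of p h s m] p h s m by simp
    also have "\<dots> \<le> l * ((lazy p ^^ n) (energy h) s / (1 - p))"
      unfolding p(3) using * l by (rule mult_left_mono)
    finally show ?thesis by (simp add: p_def)
  qed
  then show "\<exists>n0. \<forall>n\<ge>n0. ?T n (\<lambda>s. (h s)\<^sup>2) s - (?T n h s)\<^sup>2 \<le> l / (1 - l / n) * ?T n (energy h) s"
    by (intro exI[of _ "Suc (nat \<lceil>l\<rceil>)"]) auto
qed

end

section \<open>Void events\<close>

text \<open>Compact pieces are totally bounded, so they have finite nets of every mesh
  \<open>1 / Suc m\<close>; the balls of that radius around the net points form the base. A mesh
  below \<open>e / 2\<close> keeps such a ball, if it contains \<open>x\<close>, inside
  \<open>ball x e\<close>.\<close>

lemma sigma_compact_countable_base: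
  assumes "sigma_compact (UNIV :: 'a::metric_space set)"
  obtains B :: "'a::metric_space set set" where "countable B" "\<And>U. U \<in> B \<Longrightarrow> open U"
    "\<And>x S. open S \<Longrightarrow> x \<in> S \<Longrightarrow> \<exists>U\<in>B. x \<in> U \<and> U \<subseteq> S"
proof -
  obtain K :: "nat \<Rightarrow> 'a set" where K: "\<And>n. compact (K n)" "(\<Union>n. K n) = UNIV"
    using assms by (auto simp: sigma_compact_def)
  have "\<exists>k. finite k \<and> K n \<subseteq> (\<Union>x\<in>k. ball x (1 / real (Suc m)))" for n m
    using K(1)[of n] unfolding compact_eq_totally_bounded by (auto dest!: spec[of _ "1 / real (Suc m)"])
  then obtain k where k: "\<And>n m. finite (k n m)" "\<And>n m. K n \<subseteq> (\<Union>x\<in>k n m. ball x (1 / real (Suc m)))"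
    by metis
  define B where "B = (\<Union>n m. (\<lambda>x. ball x (1 / real (Suc m))) ` k n m)"
  show ?thesis
  proof
    show "countable B"
      unfolding B_def using k(1) by (intro countable_UN countable_image) (auto intro: countable_finite)
    show "open U" if "U \<in> B" for U using that by (auto simp: B_def)
    show "\<exists>U\<in>B. x \<in> U \<and> U \<subseteq> S" if S: "open S" "x \<in> S" for x S
    proof -
      obtain e where e: "0 < e" "ball x e \<subseteq> S" using S openE by blast
      obtain m where m: "1 / real (Suc m) < e / 2"
        using e reals_Archimedean[of "e / 2"] by (auto simp: inverse_eq_divide)
      obtain n where "x \<in> K n" using K(2) by blast
      then obtain c where c: "c \<in> k n m" "x \<in> ball c (1 / real (Suc m))" using k(2)[of n m] by auto
      have "ball c (1 / real (Suc m)) \<subseteq> ball x e"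
      proof
        fix z assume "z \<in> ball c (1 / real (Suc m))"
        then show "z \<in> ball x e"
          using c(2) m dist_triangle[of x z c] by (auto simp: dist_commute)
      qed
      then show ?thesis using c e(2) unfolding B_def by blast
    qed
  qed
qed

lemma emeasure_dirac_sum:
  "A \<in> sets borel \<Longrightarrow> emeasure (dirac_sum \<omega>) A = emeasure (count_space \<omega>) (\<omega> \<inter> A)"
  unfolding dirac_sum_def by (subst emeasure_distr) (auto simp: vimage_def Int_commute)

lemma sets_dirac_sum [simp]: "sets (dirac_sum \<omega>) = sets borel"
  by (simp add: dirac_sum_def)

text \<open>Finite witnesses treat finite and infinite counts alike.\<close>

lemma le_emeasure_dirac_sum_iff:
  assumes "A \<in> sets borel"
  shows "of_nat k \<le> emeasure (dirac_sum \<omega>) A \<longleftrightarrow> (\<exists>T. T \<subseteq> \<omega> \<inter> A \<and> finite T \<and> card T = k)"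
proof (cases "finite (\<omega> \<inter> A)")
  case True
  have "(\<exists>T. T \<subseteq> \<omega> \<inter> A \<and> finite T \<and> card T = k) \<longleftrightarrow> k \<le> card (\<omega> \<inter> A)"
    using True by (metis card_mono finite_subset obtain_subset_with_card_n)
  then show ?thesis using True assms by (simp add: emeasure_dirac_sum)
next
  case False
  then show ?thesis using assms infinite_arbitrarily_large[OF False, of k]
    by (auto simp: emeasure_dirac_sum)
qed

lemma ennreal_eq_topI:
  fixes x :: ennreal
  assumes "\<And>k :: nat. of_nat k \<le> x"
  shows "x = \<top>"
proof (rule ccontr)
  assume "x \<noteq> \<top>"
  then obtain n where "x < of_nat n"
    using ennreal_Ex_less_of_nat[of x] by (auto simp: less_top)
  with assms[of n] show False by simp
qed

text \<open>Inner regularity is automatic: finite subsets of the support are compact, and their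
  cardinalities exhaust the count even when it is infinite. What remains of the Radon property is
  finiteness on compact sets.\<close>

lemma configurations_iff:
  "\<omega> \<in> configurations \<longleftrightarrow> countable \<omega> \<and> (\<forall>K. compact K \<longrightarrow> finite (\<omega> \<inter> K))"
proof (intro iffI conjI allI impI)
  assume w: "\<omega> \<in> configurations"
  show "countable \<omega>" using w by (simp add: configurations_def)
  fix K :: "'a set" assume K: "compact K"
  then have "emeasure (dirac_sum \<omega>) K < \<infinity>" "K \<in> sets borel"
    using w by (auto simp: configurations_def radon_measure_def borel_compact)
  then show "finite (\<omega> \<inter> K)"
    by (auto simp: emeasure_dirac_sum emeasure_count_space split: if_splits)
next
  assume w: "countable \<omega> \<and> (\<forall>K. compact K \<longrightarrow> finite (\<omega> \<inter> K))"
  have fin: "emeasure (dirac_sum \<omega>) K < \<infinity>" if "compact K" for K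
    using w that by (simp add: emeasure_dirac_sum borel_compact of_nat_less_top)
  have "emeasure (dirac_sum \<omega>) A = (SUP K\<in>{K. compact K \<and> K \<subseteq> A}. emeasure (dirac_sum \<omega>) K)"
    if A: "A \<in> sets borel" for A
  proof (rule antisym)
    let ?S = "SUP K\<in>{K. compact K \<and> K \<subseteq> A}. emeasure (dirac_sum \<omega>) K"
    have le: "of_nat (card T) \<le> ?S" if "finite T" "T \<subseteq> \<omega> \<inter> A" for T
    proof (rule SUP_upper2)
      show "T \<in> {K. compact K \<and> K \<subseteq> A}" using that by (auto intro: finite_imp_compact)
      have "\<omega> \<inter> T = T" using that by auto
      then show "of_nat (card T) \<le> emeasure (dirac_sum \<omega>) T"
        using that by (simp add: emeasure_dirac_sum borel_compact finite_imp_compact)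
    qed
    show "emeasure (dirac_sum \<omega>) A \<le> ?S"
    proof (cases "finite (\<omega> \<inter> A)")
      case True
      then show ?thesis using le[of "\<omega> \<inter> A"] A by (simp add: emeasure_dirac_sum)
    next
      case False
      have "of_nat k \<le> ?S" for k
        using infinite_arbitrarily_large[OF False, of k] le by auto
      then have "?S = \<top>"
        by (rule ennreal_eq_topI)
      then show ?thesis by (simp only: top_greatest)
    qed
    show "?S \<le> emeasure (dirac_sum \<omega>) A"
      using A by (auto intro!: SUP_least emeasure_mono)
  qed
  then show "\<omega> \<in> configurations"
    using w fin by (simp add: configurations_def radon_measure_def)
qed

lemma configurations_subset: "\<omega> \<in> configurations \<Longrightarrow> \<omega>' \<subseteq> \<omega> \<Longrightarrow> \<omega>' \<in> configurations"
  unfolding configurations_iff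
  by (meson countable_subset finite_subset Int_mono subset_refl)

lemma configurations_Un_finite: "\<omega> \<in> configurations \<Longrightarrow> finite T \<Longrightarrow> \<omega> \<union> T \<in> configurations"
  unfolding configurations_iff by (auto simp: Int_Un_distrib2 countable_finite)

definition void_event :: "'a::metric_space set \<Rightarrow> 'a set set" where
  "void_event A = {\<omega> \<in> configurations. \<omega> \<inter> A = {}}"

text \<open>Restricted to finite intensity, where the Poisson law prescribes the probability
  \<open>exp (- measure \<nu> A)\<close>. The family is still closed under intersection, which
  corresponds to the union of the sets \<open>A\<close>.\<close>

definition void_events :: "'a::metric_space measure \<Rightarrow> 'a set set set" where
  "void_events \<nu> = {void_event A | A. A \<in> sets borel \<and> emeasure \<nu> A < \<infinity>}"

lemma space_config_space [simp]: "space config_space = configurations"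
  by (simp add: config_space_def space_measure_of_conv)

lemma emeasure_dirac_sum_measurable [measurable]:
  assumes "A \<in> sets borel"
  shows "(\<lambda>\<omega>. emeasure (dirac_sum \<omega>) A) \<in> borel_measurable config_space"
proof (rule measurableI)
  fix B :: "ennreal set" assume "B \<in> sets borel"
  then have "{\<omega> \<in> configurations. emeasure (dirac_sum \<omega>) A \<in> B} \<in> sets config_space"
    unfolding config_space_def using assms by (intro in_measure_of) auto
  also have "{\<omega> \<in> configurations. emeasure (dirac_sum \<omega>) A \<in> B}
      = (\<lambda>\<omega>. emeasure (dirac_sum \<omega>) A) -` B \<inter> space config_space" by auto
  finally show "(\<lambda>\<omega>. emeasure (dirac_sum \<omega>) A) -` B \<inter> space config_space \<in> sets config_space" .
qed simp

lemma void_event_eq: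
  assumes "A \<in> sets borel"
  shows "void_event A = {\<omega> \<in> space config_space. emeasure (dirac_sum \<omega>) A = 0}"
  using assms by (auto simp: void_event_def emeasure_dirac_sum emeasure_count_space_eq_0)

lemma sets_void_event [measurable]:
  assumes [measurable]: "A \<in> sets borel"
  shows "void_event A \<in> sets config_space"
  unfolding void_event_eq[OF assms] by measurable

lemma void_events_Int_stable: "Int_stable (void_events \<nu>)" if "sets \<nu> = sets borel"
proof (rule Int_stableI)
  fix a b assume "a \<in> void_events \<nu>" "b \<in> void_events \<nu>"
  then obtain A B where AB: "a = void_event A" "b = void_event B" "A \<in> sets borel" "B \<in> sets borel"
    "emeasure \<nu> A < \<infinity>" "emeasure \<nu> B < \<infinity>" by (auto simp: void_events_def)
  have "emeasure \<nu> (A \<union> B) \<le> emeasure \<nu> A + emeasure \<nu> B"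
    using AB that by (intro emeasure_subadditive) auto
  also have "\<dots> < \<infinity>" using AB by simp
  finally have "void_event (A \<union> B) \<in> void_events \<nu>"
    using AB by (auto simp: void_events_def)
  moreover have "a \<inter> b = void_event (A \<union> B)"
    using AB by (auto simp: void_event_def)
  ultimately show "a \<inter> b \<in> void_events \<nu>" by simp
qed

text \<open>A point count \<open>\<ge> k\<close> in \<open>A\<close> is witnessed by \<open>k\<close> pairwise disjoint members of a countable
  base, each meeting the configuration inside \<open>A\<close>; so counts are measurable with respect to
  void events.\<close>

lemma sets_config_space_eq:
  fixes \<nu> :: "'a::metric_space measure"
  assumes X: "sigma_compact (UNIV :: 'a set)" and \<nu>: "radon_measure \<nu>"
  shows "sets config_space = sigma_sets configurations (void_events \<nu>)"
proof
  let ?V = "sigma configurations (void_events \<nu>)"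
  have sub: "void_events \<nu> \<subseteq> Pow configurations"
    by (auto simp: void_events_def void_event_def)
  have V: "sets ?V = sigma_sets configurations (void_events \<nu>)" "space ?V = configurations"
    using sub by (simp_all add: sets_measure_of_conv space_measure_of_conv)
  show "sigma_sets configurations (void_events \<nu>) \<subseteq> sets config_space"
  proof -
    have "void_events \<nu> \<subseteq> sets config_space" by (auto simp: void_events_def)
    from sets.sigma_sets_subset[OF this] show ?thesis by simp
  qed
  obtain K :: "nat \<Rightarrow> 'a set" where K: "\<And>n. compact (K n)" "(\<Union>n. K n) = UNIV"
    using X by (auto simp: sigma_compact_def)
  \<comment> \<open>An arbitrary Borel set is cut along the compact exhaustion, whose pieces have
    finite intensity.\<close>
  have void: "void_event A \<in> sets ?V" if A: "A \<in> sets borel" for A :: "'a set"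
  proof -
    have "emeasure \<nu> (A \<inter> K n) < \<infinity>" for n
    proof -
      have "emeasure \<nu> (A \<inter> K n) \<le> emeasure \<nu> (K n)"
        using \<nu> K(1) by (intro emeasure_mono) (auto simp: radon_measure_def borel_compact)
      also have "\<dots> < \<infinity>" using \<nu> K(1) by (simp add: radon_measure_def)
      finally show ?thesis .
    qed
    then have "void_event (A \<inter> K n) \<in> void_events \<nu>" for n
      using A K(1) unfolding void_events_def by (blast intro: sets.Int borel_compact)
    then have "void_event (A \<inter> K n) \<in> sets ?V" for n
      unfolding V by (rule sigma_sets.Basic)
    then have "(\<Inter>n. void_event (A \<inter> K n)) \<in> sets ?V" by (intro sets.countable_INT) auto
    also have "(\<Inter>n. void_event (A \<inter> K n)) = void_event A"
      using K(2) by (auto simp: void_event_def)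
    finally show ?thesis .
  qed
  obtain \<B> :: "'a set set" where \<B>: "countable \<B>" "\<And>U. U \<in> \<B> \<Longrightarrow> open U"
    "\<And>x S. open S \<Longrightarrow> x \<in> S \<Longrightarrow> \<exists>U\<in>\<B>. x \<in> U \<and> U \<subseteq> S"
    using sigma_compact_countable_base[OF X] by metis
  have count: "{\<omega> \<in> configurations. of_nat k \<le> emeasure (dirac_sum \<omega>) A} \<in> sets ?V"
    if A: "A \<in> sets borel" for A :: "'a set" and k
  proof -
    define \<D> where "\<D> = {\<U>. finite \<U> \<and> \<U> \<subseteq> \<B> \<and> disjoint \<U> \<and> card \<U> = k}"
    have "{\<omega> \<in> configurations. of_nat k \<le> emeasure (dirac_sum \<omega>) A}
        = (\<Union>\<U>\<in>\<D>. {\<omega> \<in> configurations. \<forall>U\<in>\<U>. \<omega> \<notin> void_event (A \<inter> U)})"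
    proof (intro equalityI subsetI)
      fix \<omega> assume "\<omega> \<in> {\<omega> \<in> configurations. of_nat k \<le> emeasure (dirac_sum \<omega>) A}"
      then obtain T where w: "\<omega> \<in> configurations" and T: "T \<subseteq> \<omega> \<inter> A" "finite T" "card T = k"
        using le_emeasure_dirac_sum_iff[OF A] by auto
      \<comment> \<open>A positive lower bound for the distances within \<open>T\<close>, so that
        balls of radius \<open>d / 2\<close> around its points are disjoint. The extra 1 in the
        minimum covers empty \<open>T\<close>.\<close>
      obtain d where d: "d > 0" "\<And>x y. x \<in> T \<Longrightarrow> y \<in> T \<Longrightarrow> x \<noteq> y \<Longrightarrow> d \<le> dist x y"
      proof -
        have "\<exists>d>0. \<forall>y\<in>T. y \<noteq> x \<longrightarrow> d \<le> dist x y" for x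
          by (rule finite_set_avoid[OF T(2)])
        then obtain f where f: "\<And>x. f x > 0" "\<And>x y. y \<in> T \<Longrightarrow> y \<noteq> x \<Longrightarrow> f x \<le> dist x y"
          by metis
        have "\<forall>x\<in>T. Min (insert 1 (f ` T)) \<le> f x" "Min (insert 1 (f ` T)) > 0"
          using T(2) f(1) by auto
        then show ?thesis using that[of "Min (insert 1 (f ` T))"] f(2) by (metis order_trans)
      qed
      have "\<exists>U\<in>\<B>. x \<in> U \<and> U \<subseteq> ball x (d / 2)" for x
        using d(1) by (intro \<B>(3)) auto
      then obtain u where u: "\<And>x. u x \<in> \<B>" "\<And>x. x \<in> u x" "\<And>x. u x \<subseteq> ball x (d / 2)" by metis
      have disj: "u x \<inter> u y = {}" if "x \<in> T" "y \<in> T" "x \<noteq> y" for x y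
      proof -
        have False if "z \<in> u x" "z \<in> u y" for z
        proof -
          have "dist x z < d / 2" "dist y z < d / 2" using subsetD[OF u(3) that(1)] subsetD[OF u(3) that(2)] by auto
          then show False using d(2)[OF \<open>x \<in> T\<close> \<open>y \<in> T\<close> \<open>x \<noteq> y\<close>] dist_triangle2[of x y z] by linarith
        qed
        then show ?thesis by blast
      qed
      have "inj_on u T" by (rule inj_onI) (metis disj u(2) disjoint_iff)
      then have "u ` T \<in> \<D>"
        using T u(1) disj by (auto simp: \<D>_def card_image pairwise_def disjnt_def)
      moreover have "\<forall>U\<in>u ` T. \<omega> \<notin> void_event (A \<inter> U)"
        using T(1) u(2) by (auto simp: void_event_def)
      ultimately show "\<omega> \<in> (\<Union>\<U>\<in>\<D>. {\<omega> \<in> configurations. \<forall>U\<in>\<U>. \<omega> \<notin> void_event (A \<inter> U)})"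
        using w by (intro UN_I[of "u ` T"]) auto
    next
      fix \<omega> assume "\<omega> \<in> (\<Union>\<U>\<in>\<D>. {\<omega> \<in> configurations. \<forall>U\<in>\<U>. \<omega> \<notin> void_event (A \<inter> U)})"
      then obtain \<U> where w: "\<omega> \<in> configurations" and U: "\<U> \<in> \<D>" "\<forall>U\<in>\<U>. \<omega> \<inter> (A \<inter> U) \<noteq> {}"
        by (auto simp: void_event_def)
      then have "\<forall>U\<in>\<U>. \<exists>z. z \<in> \<omega> \<inter> (A \<inter> U)" by blast
      then obtain t where t: "\<And>U. U \<in> \<U> \<Longrightarrow> t U \<in> \<omega> \<inter> (A \<inter> U)" by metis
      have "inj_on t \<U>"
      proof (rule inj_onI, rule ccontr)
        fix U V assume UV: "U \<in> \<U>" "V \<in> \<U>" "t U = t V" "U \<noteq> V"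
        then have "U \<inter> V = {}" using U(1) by (auto simp: \<D>_def pairwise_def disjnt_def)
        then show False using t[OF UV(1)] t[OF UV(2)] UV(3) by auto
      qed
      then have "card (t ` \<U>) = k" using U(1) by (auto simp: \<D>_def card_image)
      then show "\<omega> \<in> {\<omega> \<in> configurations. of_nat k \<le> emeasure (dirac_sum \<omega>) A}"
        using w t U(1) unfolding le_emeasure_dirac_sum_iff[OF A]
        by (auto simp: \<D>_def intro!: exI[of _ "t ` \<U>"])
    qed
    also have "\<dots> \<in> sets ?V"
    proof (rule sets.countable_UN'')
      have "countable {\<U>. finite \<U> \<and> \<U> \<subseteq> \<B>}"
        using \<B>(1) by (rule countable_Collect_finite_subset)
      then show "countable \<D>" by (rule countable_subset[rotated]) (auto simp: \<D>_def)
      fix \<U> assume U: "\<U> \<in> \<D>"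
      have "(\<Union>U\<in>\<U>. void_event (A \<inter> U)) \<in> sets ?V"
        using U \<B>(2) A by (intro sets.finite_UN void) (auto simp: \<D>_def)
      then have "space ?V - (\<Union>U\<in>\<U>. void_event (A \<inter> U)) \<in> sets ?V" by (rule sets.compl_sets)
      also have "space ?V - (\<Union>U\<in>\<U>. void_event (A \<inter> U)) = {\<omega> \<in> configurations. \<forall>U\<in>\<U>. \<omega> \<notin> void_event (A \<inter> U)}"
        unfolding V by auto
      finally show "{\<omega> \<in> configurations. \<forall>U\<in>\<U>. \<omega> \<notin> void_event (A \<inter> U)} \<in> sets ?V" .
    qed
    finally show ?thesis .
  qed
  have meas: "(\<lambda>\<omega>. emeasure (dirac_sum \<omega>) A) \<in> borel_measurable ?V" if A: "A \<in> sets borel" for A :: "'a set"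
  proof -
    \<comment> \<open>A count is the supremum of the integers below it, which stays true if it is
      infinite; this expresses it through the sets just shown measurable.\<close>
    have "emeasure (dirac_sum \<omega>) A
        = (SUP k. of_nat k * indicator {\<omega> \<in> configurations. of_nat k \<le> emeasure (dirac_sum \<omega>) A} \<omega>)"
      if "\<omega> \<in> space ?V" for \<omega>
    proof (rule antisym)
      have w: "\<omega> \<in> configurations" using that by (simp only: V(2))
      let ?S = "SUP k. (of_nat k :: ennreal) * indicator {\<omega> \<in> configurations. of_nat k \<le> emeasure (dirac_sum \<omega>) A} \<omega>"
      have le: "of_nat k \<le> ?S" if "of_nat k \<le> emeasure (dirac_sum \<omega>) A" for k
        using that w by (intro SUP_upper2[of k]) auto
      show "emeasure (dirac_sum \<omega>) A \<le> ?S"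
      proof (cases "finite (\<omega> \<inter> A)")
        case True
        then have "emeasure (dirac_sum \<omega>) A = of_nat (card (\<omega> \<inter> A))"
          using A by (simp add: emeasure_dirac_sum)
        then show ?thesis using le[of "card (\<omega> \<inter> A)"] by simp
      next
        case False
        then have "of_nat k \<le> ?S" for k
          using A by (intro le) (simp add: emeasure_dirac_sum)
        then have "?S = \<top>"
          by (rule ennreal_eq_topI)
        then show ?thesis by (simp only: top_greatest)
      qed
      show "?S \<le> emeasure (dirac_sum \<omega>) A"
        by (intro SUP_least) (auto split: split_indicator)
    qed
    moreover have "(\<lambda>\<omega>. SUP k. (of_nat k :: ennreal) * indicator {\<omega> \<in> configurations. of_nat k \<le> emeasure (dirac_sum \<omega>) A} \<omega>)
        \<in> borel_measurable ?V"
      by (rule borel_measurable_SUP, simp)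
        (rule borel_measurable_times_ennreal, simp, rule borel_measurable_indicator, rule count[OF A])
    ultimately show ?thesis
      by (rule iffD2[OF measurable_cong])
  qed
  have "{\<omega> \<in> configurations. emeasure (dirac_sum \<omega>) A \<in> B} \<in> sets ?V"
    if "A \<in> sets borel" "B \<in> sets borel" for A :: "'a set" and B
    using measurable_sets[OF meas[OF that(1)] that(2)] unfolding V(2) vimage_def Int_def mem_Collect_eq
    by (simp only: conj_commute)
  then have "sigma_sets (space ?V) {{\<omega> \<in> configurations. emeasure (dirac_sum \<omega>) A \<in> B} | A B.
        A \<in> sets (borel :: 'a measure) \<and> B \<in> sets (borel :: ennreal measure)} \<subseteq> sets ?V"
    by (intro sets.sigma_sets_subset) auto
  then show "sets config_space \<subseteq> sigma_sets configurations (void_events \<nu>)"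
    unfolding V config_space_def by (subst sets_measure_of) auto
qed

section \<open>Resampling a Poisson configuration\<close>

text \<open>Void events generate the sigma-algebra, so it is enough to test when \<open>f x\<close>
  avoids a Borel set; \<nu> selects the generating family.\<close>

lemma measurable_config_spaceI:
  fixes f :: "'b \<Rightarrow> 'a::metric_space set"
  assumes X: "sigma_compact (UNIV :: 'a set)" "radon_measure (\<nu> :: 'a measure)"
    and f: "\<And>x. x \<in> space M \<Longrightarrow> f x \<in> configurations"
      "\<And>A. A \<in> sets borel \<Longrightarrow> {x \<in> space M. f x \<inter> A = {}} \<in> sets M"
  shows "f \<in> measurable M config_space"
proof (rule measurable_sigma_sets[OF sets_config_space_eq[OF X]])
  show "void_events \<nu> \<subseteq> Pow configurations"
    by (auto simp: void_events_def void_event_def)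
  show "f \<in> space M \<rightarrow> configurations" using f(1) by auto
  fix y assume "y \<in> void_events \<nu>"
  then obtain A where A: "y = void_event A" "A \<in> sets borel" by (auto simp: void_events_def)
  then have "f -` y \<inter> space M = {x \<in> space M. f x \<inter> A = {}}"
    using f(1) by (auto simp: void_event_def)
  then show "f -` y \<inter> space M \<in> sets M" using f(2)[OF A(2)] by simp
qed

lemma configurations_diff [simp]: "\<omega> \<in> configurations \<Longrightarrow> \<omega> - D \<in> configurations"
  by (rule configurations_subset) auto

locale poisson_config = prob_space P for P :: "'a::metric_space set measure" +
  fixes \<nu> :: "'a measure"
  assumes sigma_compact_UNIV: "sigma_compact (UNIV :: 'a set)"
    and radon: "radon_measure \<nu>"
    and poisson: "poisson_measure \<nu> P"
begin

lemma sets_P [measurable_cong]: "sets P = sets config_space"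
  using poisson by (simp add: poisson_measure_def)

lemma space_P: "space P = configurations"
  using sets_eq_imp_space_eq[OF sets_P] by simp

lemma sets_nu [measurable_cong]: "sets \<nu> = sets borel"
  using radon by (simp add: radon_measure_def)

lemma prob_void_event:
  assumes A: "A \<in> sets borel" "emeasure \<nu> A < \<infinity>"
  shows "prob (void_event A) = exp (- measure \<nu> A)"
proof -
  have "\<forall>n::nat. prob {\<omega> \<in> space P. emeasure (dirac_sum \<omega>) A = of_nat n}
      = exp (- measure \<nu> A) * measure \<nu> A ^ n / fact n"
    using poisson A unfolding poisson_measure_def by blast
  from this[rule_format, of 0] show ?thesis
    using A by (simp add: void_event_eq space_P)
qed

lemma measurable_diff_config [measurable]:
  assumes [measurable]: "(D :: 'a set) \<in> sets borel"
  shows "(\<lambda>\<omega>. \<omega> - D) \<in> measurable config_space config_space"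
proof (rule measurable_config_spaceI[OF sigma_compact_UNIV radon])
  show "\<omega> - D \<in> configurations" if "\<omega> \<in> space config_space" for \<omega>
    using that by simp
  fix A :: "'a set" assume [measurable]: "A \<in> sets borel"
  have "{\<omega> \<in> space config_space. (\<omega> - D) \<inter> A = {}} = void_event (A - D)"
    by (auto simp: void_event_def)
  then show "{\<omega> \<in> space config_space. (\<omega> - D) \<inter> A = {}} \<in> sets config_space" by simp
qed

end

text \<open>A unit-mass normalisation of the intensity on a set \<open>E\<close> of finite measure \<open>l\<close>; the
  equation holds for every \<open>M\<close> if \<open>l = 0\<close>.\<close>

locale poisson_config_on = poisson_config P \<nu> + M: prob_space M
  for P :: "'a::metric_space set measure" and \<nu> and M :: "'a measure" +
  fixes E :: "'a set" and l :: real
  assumes E_sets [measurable]: "E \<in> sets borel"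
    and sets_M [measurable_cong]: "sets M = sets borel"
    and l_nonneg: "0 \<le> l"
    and emeasure_nu: "\<And>A. A \<in> sets borel \<Longrightarrow> emeasure \<nu> (A \<inter> E) = ennreal (l * measure M (A \<inter> E))"
begin

text \<open>The intersection discards a draw outside \<open>E\<close>, which may occur when
  \<open>E\<close> has intensity zero and \<open>M\<close> is arbitrary.\<close>

definition add_point :: "'a \<Rightarrow> 'a set \<Rightarrow> 'a set" where
  "add_point y \<omega> = \<omega> \<union> ({y} \<inter> E)"

lemma add_point_measurable: "(\<lambda>(y, \<omega>). add_point y \<omega>) \<in> measurable (M \<Otimes>\<^sub>M config_space) config_space"
proof (rule measurable_config_spaceI[OF sigma_compact_UNIV radon])
  fix x :: "'a \<times> 'a set" assume "x \<in> space (M \<Otimes>\<^sub>M config_space)"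
  then show "(case x of (y, \<omega>) \<Rightarrow> add_point y \<omega>) \<in> configurations"
    by (cases x) (simp add: space_pair_measure add_point_def configurations_Un_finite)
next
  fix A :: "'a set" assume [measurable]: "A \<in> sets borel"
  have "{x \<in> space (M \<Otimes>\<^sub>M config_space). (case x of (y, \<omega>) \<Rightarrow> add_point y \<omega>) \<inter> A = {}}
      = (space M - (E \<inter> A)) \<times> void_event A"
    by (auto simp: space_pair_measure void_event_def add_point_def)
  also have "\<dots> \<in> sets (M \<Otimes>\<^sub>M config_space)" by measurable
  finally show "{x \<in> space (M \<Otimes>\<^sub>M config_space). (case x of (y, \<omega>) \<Rightarrow> add_point y \<omega>) \<inter> A = {}}
      \<in> sets (M \<Otimes>\<^sub>M config_space)" .
qed

sublocale commuting_jumps M config_space add_point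
  by (unfold_locales, rule add_point_measurable) (simp add: add_point_def Un_ac)

primrec added :: "nat \<Rightarrow> 'a set measure" where
  "added 0 = distr P config_space (\<lambda>\<omega>. \<omega> - E)"
| "added (Suc k) = distr (M \<Otimes>\<^sub>M added k) config_space (\<lambda>(y, \<omega>). add_point y \<omega>)"

lemma sets_added [simp, measurable_cong]: "sets (added k) = sets config_space"
  by (cases k) auto

lemma space_added [simp]: "space (added k) = configurations"
  using sets_eq_imp_space_eq[OF sets_added] by simp

lemma prob_space_added: "prob_space (added k)"
proof (induction k)
  case 0
  show ?case unfolding added.simps by (rule prob_space_distr) measurable
next
  case (Suc k)
  interpret K: prob_space "added k" by fact
  interpret pair_prob_space M "added k" ..
  show ?case unfolding added.simps by (rule P.prob_space_distr) measurable
qed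

text \<open>Fubini turns the push-forward of laws into the operator \<open>avg\<close> on functions,
  so results on the walk become results on configurations cleared on \<open>E\<close> and refilled
  by \<open>k\<close> independent draws.\<close>

lemma integral_added:
  assumes "bounded_measurable config_space h"
  shows "(\<integral>\<omega>. h \<omega> \<partial>added k) = expectation (\<lambda>\<omega>. (avg ^^ k) h (\<omega> - E))"
  using assms
proof (induction k arbitrary: h)
  case 0
  then have [measurable]: "h \<in> borel_measurable config_space" by (rule bounded_measurableD)
  show ?case by (simp add: integral_distr)
next
  case (Suc k)
  interpret K: prob_space "added k" by (rule prob_space_added)
  interpret MK: pair_prob_space M "added k" ..
  have [measurable]: "h \<in> borel_measurable config_space" using Suc.prems by (rule bounded_measurableD)
  have h: "bounded_measurable (M \<Otimes>\<^sub>M added k) (\<lambda>(y, \<omega>). h (add_point y \<omega>))"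
    using bounded_measurable_compose[OF Suc.prems, of "\<lambda>(y, \<omega>). add_point y \<omega>" "M \<Otimes>\<^sub>M added k"]
    by (simp add: case_prod_beta')
  have "(\<integral>\<omega>. h \<omega> \<partial>added (Suc k)) = (\<integral>(y, \<omega>). h (add_point y \<omega>) \<partial>(M \<Otimes>\<^sub>M added k))"
    by (simp add: integral_distr case_prod_beta')
  also have "\<dots> = (\<integral>\<omega>. avg h \<omega> \<partial>added k)"
    unfolding avg_def by (rule MK.integral_snd[symmetric]) (rule MK.P.integrable_bounded_measurable[OF h])
  also have "\<dots> = expectation (\<lambda>\<omega>. (avg ^^ k) (avg h) (\<omega> - E))"
    using Suc by auto
  finally show ?case by (simp add: funpow_swap1)
qed

definition resampled :: "'a set measure" where
  "resampled = measure_pmf (poisson_pmf0 l) \<bind> added"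

lemma added_kernel [measurable]: "added \<in> measurable (measure_pmf p) (subprob_algebra config_space)"
  by (rule measurableI) (auto simp: space_subprob_algebra prob_space_imp_subprob_space prob_space_added)

lemma sets_resampled [simp, measurable_cong]: "sets resampled = sets config_space"
  unfolding resampled_def by (rule sets_bind) auto

lemma prob_space_resampled: "prob_space resampled"
  unfolding resampled_def
  by (rule measure_pmf.prob_space_bind[OF _ added_kernel]) (simp add: prob_space_added)

lemma integral_resampled:
  assumes h: "bounded_measurable config_space h"
  shows "(\<integral>\<omega>. h \<omega> \<partial>resampled) = expectation (\<lambda>\<omega>. poisson_avg l h (\<omega> - E))"
proof -
  interpret PP: pair_prob_space "measure_pmf (poisson_pmf0 l)" P ..
  obtain B where B: "\<And>s. s \<in> configurations \<Longrightarrow> \<bar>h s\<bar> \<le> B"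
    using h by (metis bounded_measurable_bound space_config_space)
  have "(\<integral>\<omega>. h \<omega> \<partial>resampled) = (\<integral>k. (\<integral>\<omega>. h \<omega> \<partial>added k) \<partial>measure_pmf (poisson_pmf0 l))"
    unfolding resampled_def
  proof (rule integral_bind)
    show "h \<in> borel_measurable config_space" using h by (rule bounded_measurableD)
    show "\<bar>h s\<bar> \<le> B" if "s \<in> space config_space" for s using that B by simp
    show "added \<in> measurable (measure_pmf (poisson_pmf0 l)) (subprob_algebra config_space)"
      by (rule added_kernel)
    show "finite_measure (measure_pmf (poisson_pmf0 l))" by (rule measure_pmf.finite_measure_axioms)
    show "AE k in measure_pmf (poisson_pmf0 l). emeasure (added k) (space (added k)) \<le> ennreal 1"
      using prob_space.emeasure_space_1[OF prob_space_added] by simp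
  qed
  also have "\<dots> = (\<integral>k. (\<integral>\<omega>. (avg ^^ k) h (\<omega> - E) \<partial>P) \<partial>measure_pmf (poisson_pmf0 l))"
    using h by (simp add: integral_added)
  also have "\<dots> = (\<integral>\<omega>. (\<integral>k. (avg ^^ k) h (\<omega> - E) \<partial>measure_pmf (poisson_pmf0 l)) \<partial>P)"
  proof (rule PP.Fubini_integral[symmetric, unfolded case_prod_beta'])
    have [measurable]: "(avg ^^ k) h \<in> borel_measurable config_space" for k
      using h by (intro bounded_measurableD bounded_measurable_avg_pow)
    have "(\<lambda>x. (avg ^^ fst x) h (snd x - E)) \<in> borel_measurable (count_space UNIV \<Otimes>\<^sub>M P)"
      by (rule measurable_pair_measure_countable1) auto
    then have "(\<lambda>x. (avg ^^ fst x) h (snd x - E)) \<in> borel_measurable (measure_pmf (poisson_pmf0 l) \<Otimes>\<^sub>M P)"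
      by (simp cong: measurable_cong_sets)
    moreover have "\<bar>(avg ^^ k) h (\<omega> - E)\<bar> \<le> B" if "\<omega> \<in> configurations" for k \<omega>
      using h B that by (intro avg_pow_abs_le) auto
    ultimately show "integrable (measure_pmf (poisson_pmf0 l) \<Otimes>\<^sub>M P) (\<lambda>x. (avg ^^ fst x) h (snd x - E))"
      by (intro PP.P.integrable_bounded_measurable bounded_measurableI[where B = B])
        (auto simp: space_pair_measure space_P)
  qed
  finally show ?thesis by (simp add: poisson_avg_def)
qed

text \<open>Each draw avoids \<open>A \<inter> E\<close> with probability \<open>1 - q\<close>,
  where \<open>q = measure M (A \<inter> E)\<close>, so \<open>k\<close> draws give the factor
  \<open>(1 - q) ^ k\<close>. The Poisson generating function at \<open>1 - q\<close> is
  \<open>exp (- l * q)\<close>.\<close>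

lemma poisson_avg_void_event:
  assumes A: "A \<in> sets borel" and s: "s \<in> configurations"
  shows "poisson_avg l (indicator (void_event A)) s = indicator (void_event A) s * exp (- l * measure M (A \<inter> E))"
proof -
  let ?q = "measure M (A \<inter> E)"
  note [measurable] = A
  have "(avg ^^ k) (indicator (void_event A)) s = indicator (void_event A) s * (1 - ?q) ^ k"
    for k using s
  proof (induction k arbitrary: s)
    case (Suc k)
    have "(avg ^^ Suc k) (indicator (void_event A)) s
        = (\<integral>y. indicator (void_event A) (add_point y s) * (1 - ?q) ^ k \<partial>M)"
      unfolding funpow.simps o_apply avg_def[of _ s]
      using Suc.prems act_space by (intro Bochner_Integration.integral_cong refl Suc.IH) simp
    also have "\<dots> = (\<integral>y. indicator (void_event A) s * (1 - ?q) ^ k * indicator (space M - A \<inter> E) y \<partial>M)"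
      using Suc.prems act_space[of _ s]
      by (intro Bochner_Integration.integral_cong refl) (auto simp: void_event_def add_point_def split: split_indicator)
    also have "\<dots> = indicator (void_event A) s * (1 - ?q) ^ k * measure M (space M - A \<inter> E)"
      by simp
    finally show ?case by (simp add: M.prob_compl)
  qed simp
  then have "poisson_avg l (indicator (void_event A)) s
      = indicator (void_event A) s * measure_pmf.expectation (poisson_pmf0 l) (\<lambda>k. (1 - ?q) ^ k)"
    by (simp add: poisson_avg_def)
  also have "measure_pmf.expectation (poisson_pmf0 l) (\<lambda>k. (1 - ?q) ^ k)
      = (\<Sum>k. l ^ k / fact k * exp (- l) * (1 - ?q) ^ k)"
    using l_nonneg by (intro expectation_poisson_pmf0[where B = 1]) (auto simp: power_abs intro!: power_le_one)
  also have "\<dots> = (\<Sum>k. exp (- l) * ((l * (1 - ?q)) ^ k /\<^sub>R fact k))"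
    unfolding power_mult_distrib by (simp add: divide_inverse mult_ac)
  also have "\<dots> = exp (- l) * exp (l * (1 - ?q))"
    by (subst suminf_mult) (auto simp: exp_def summable_exp)
  also have "\<dots> = exp (- l * ?q)"
    by (simp add: exp_add[symmetric] algebra_simps)
  finally show ?thesis .
qed

text \<open>On a void event for \<open>A\<close>, the retained points must avoid
  \<open>A - E\<close>, with probability \<open>exp (- measure \<nu> (A - E))\<close>, and the new
  ones contribute the deterministic factor \<open>exp (- l * measure M (A \<inter> E))\<close>. The
  exponents add up to that of \<open>P\<close>.\<close>

theorem resampled_eq: "resampled = P"
proof (rule measure_eqI_generator_eq[OF void_events_Int_stable[OF sets_nu]])
  interpret R: prob_space resampled by (rule prob_space_resampled)
  show "void_events \<nu> \<subseteq> Pow configurations"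
    by (auto simp: void_events_def void_event_def)
  show "sets resampled = sigma_sets configurations (void_events \<nu>)"
    "sets P = sigma_sets configurations (void_events \<nu>)"
    using sets_config_space_eq[OF sigma_compact_UNIV radon] by (simp_all add: sets_P)
  \<comment> \<open>\<open>void_event {}\<close> is the whole space, so the exhausting sequence may
    be constant.\<close>
  show "range (\<lambda>i::nat. void_event {}) \<subseteq> void_events \<nu>" by (auto simp: void_events_def)
  show "(\<Union>i::nat. void_event {}) = configurations" by (auto simp: void_event_def)
  show "emeasure resampled (void_event {}) \<noteq> \<infinity>" for i :: nat by simp
  fix V assume "V \<in> void_events \<nu>"
  then obtain A where A: "V = void_event A" and [measurable]: "A \<in> sets borel" and fin: "emeasure \<nu> A < \<infinity>"
    by (auto simp: void_events_def)
  have fin': "emeasure \<nu> (A - E) < \<infinity>" "emeasure \<nu> (A \<inter> E) < \<infinity>"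
    using fin by (auto intro: le_less_trans[OF emeasure_mono])
  have "measure \<nu> A = measure \<nu> (A - E) + measure \<nu> (A \<inter> E)"
    using fin' by (subst measure_Union[symmetric]) (auto simp: Un_Diff_Int)
  also have "measure \<nu> (A \<inter> E) = l * measure M (A \<inter> E)"
    using emeasure_nu[of A] l_nonneg by (simp add: measure_def)
  finally have nuA: "measure \<nu> A = measure \<nu> (A - E) + l * measure M (A \<inter> E)" .
  have "measure resampled V = (\<integral>\<omega>. indicator (void_event A) \<omega> \<partial>resampled)"
    by (simp add: A)
  also have "\<dots> = expectation (\<lambda>\<omega>. poisson_avg l (indicator (void_event A)) (\<omega> - E))"
    by (rule integral_resampled) auto
  also have "\<dots> = expectation (\<lambda>\<omega>. indicator (void_event (A - E)) \<omega> * exp (- l * measure M (A \<inter> E)))"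
    by (intro Bochner_Integration.integral_cong refl, subst poisson_avg_void_event)
      (auto simp: space_P void_event_def split: split_indicator)
  also have "\<dots> = prob (void_event (A - E)) * exp (- l * measure M (A \<inter> E))"
    by simp
  also have "\<dots> = exp (- measure \<nu> A)"
    using fin' by (simp add: prob_void_event nuA exp_add[symmetric])
  also have "\<dots> = prob V"
    using fin by (simp add: A prob_void_event)
  finally show "emeasure resampled V = emeasure P V"
    by (simp add: R.emeasure_eq_measure emeasure_eq_measure)
qed

corollary expectation_resample:
  "bounded_measurable config_space h \<Longrightarrow> expectation h = expectation (\<lambda>\<omega>. poisson_avg l h (\<omega> - E))"
  using integral_resampled[of h] by (simp add: resampled_eq)

end

section \<open>The Poincare inequality\<close>

lemma (in poisson_config) ex_poisson_config_on:
  assumes E: "E \<in> sets borel" "emeasure \<nu> E < \<infinity>"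
  shows "\<exists>M. poisson_config_on P \<nu> M E (measure \<nu> E)"
proof (cases "measure \<nu> E = 0")
  case True
  interpret M: prob_space "return borel undefined :: 'a measure"
    by (rule prob_space_return) simp
  have "emeasure \<nu> (A \<inter> E) = 0" for A
  proof -
    have "emeasure \<nu> (A \<inter> E) \<le> emeasure \<nu> E"
      using E by (intro emeasure_mono) (auto simp: sets_nu)
    also have "\<dots> = 0" using True E by (simp add: emeasure_eq_ennreal_measure less_top)
    finally show ?thesis by simp
  qed
  then have "poisson_config_on P \<nu> (return borel undefined) E (measure \<nu> E)"
    using E True by unfold_locales auto
  then show ?thesis by blast
next
  case False
  have nz: "emeasure \<nu> E \<noteq> 0" using False by (auto simp: measure_def)
  have E': "E \<in> sets \<nu>" using E by (simp add: sets_nu)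
  interpret M: prob_space "uniform_measure \<nu> E"
    using nz E by (intro prob_space_uniform_measure) auto
  have "emeasure \<nu> (A \<inter> E) = ennreal (measure \<nu> E * measure (uniform_measure \<nu> E) (A \<inter> E))"
    if A: "A \<in> sets borel" for A
  proof -
    have "emeasure \<nu> (A \<inter> E) \<le> emeasure \<nu> E"
      using E' by (intro emeasure_mono) auto
    then have "emeasure \<nu> (A \<inter> E) = ennreal (measure \<nu> (A \<inter> E))"
      using E by (intro emeasure_eq_ennreal_measure) (auto simp: top_unique)
    moreover have "measure (uniform_measure \<nu> E) (A \<inter> E) = measure \<nu> (A \<inter> E) / measure \<nu> E"
      using nz E A E' by (subst measure_uniform_measure) (auto simp: sets_nu Int_left_commute Int_absorb less_top)
    ultimately show ?thesis using False by simp
  qed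
  then have "poisson_config_on P \<nu> (uniform_measure \<nu> E) E (measure \<nu> E)"
    using E by unfold_locales (auto simp: sets_nu)
  then show ?thesis by blast
qed

section \<open>Energy as a gradient norm, and locality of the averaging operators\<close>

context poisson_config_on
begin

lemma density_nu: "density \<nu> (indicator E) = density M (\<lambda>y. ennreal l * indicator E y)"
proof (rule measure_eqI)
  fix A assume "A \<in> sets (density \<nu> (indicator E))"
  then have A: "A \<in> sets borel" by (simp add: sets_nu)
  have "emeasure (density \<nu> (indicator E)) A = emeasure \<nu> (A \<inter> E)"
    using A by (subst emeasure_density) (auto simp: sets_nu nn_integral_indicator' indicator_inter_arith[symmetric] Int_commute)
  also have "\<dots> = ennreal l * emeasure M (A \<inter> E)"
    using emeasure_nu[OF A] l_nonneg by (simp add: ennreal_mult M.emeasure_eq_measure)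
  also have "\<dots> = emeasure (density M (\<lambda>y. ennreal l * indicator E y)) A"
    using A by (subst emeasure_density)
      (auto simp: sets_M nn_integral_cmult mult.assoc indicator_inter_arith[symmetric] Int_commute)
  finally show "emeasure (density \<nu> (indicator E)) A
      = emeasure (density M (\<lambda>y. ennreal l * indicator E y)) A" .
qed (simp add: sets_nu sets_M)

lemma energy_eq_nn_integral:
  assumes h: "bounded_measurable config_space h" and s: "s \<in> configurations"
  shows "ennreal (l * energy h s) = (\<integral>\<^sup>+y. ennreal ((h (s \<union> {y}) - h s)\<^sup>2) * indicator E y \<partial>\<nu>)"
proof -
  let ?g = "\<lambda>y. (h (add_point y s) - h s)\<^sup>2"
  have g: "bounded_measurable M ?g"
    using bounded_measurable_act[OF h, of s] s by (intro bounded_measurable_power2 bounded_measurable_diff) auto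
  then have [measurable]: "?g \<in> borel_measurable M" "?g \<in> borel_measurable \<nu>"
    by (auto dest: bounded_measurableD simp: sets_nu sets_M cong: measurable_cong_sets)
  have "(\<integral>\<^sup>+y. ennreal ((h (s \<union> {y}) - h s)\<^sup>2) * indicator E y \<partial>\<nu>) = (\<integral>\<^sup>+y. ennreal (?g y) * indicator E y \<partial>\<nu>)"
    by (intro nn_integral_cong) (auto simp: add_point_def split: split_indicator)
  also have "\<dots> = (\<integral>\<^sup>+y. ennreal (?g y) \<partial>density \<nu> (indicator E))"
    by (subst nn_integral_density) (auto simp: mult.commute sets_nu)
  also have "\<dots> = (\<integral>\<^sup>+y. ennreal l * indicator E y * ennreal (?g y) \<partial>M)"
    unfolding density_nu by (subst nn_integral_density) (auto simp: sets_M)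
  also have "\<dots> = (\<integral>\<^sup>+y. ennreal l * ennreal (?g y) \<partial>M)"
    \<comment> \<open>A draw outside \<open>E\<close> is discarded, so the difference vanishes there
      and the indicator may be dropped.\<close>
    by (intro nn_integral_cong) (auto simp: add_point_def split: split_indicator)
  also have "\<dots> = ennreal l * ennreal (energy h s)"
    unfolding energy_def
    by (subst nn_integral_cmult, simp, subst nn_integral_eq_integral)
      (use g in \<open>auto intro: M.integrable_bounded_measurable\<close>)
  finally show ?thesis using l_nonneg by (simp add: ennreal_mult energy_nonneg)
qed

lemma avg_pow_restrict:
  assumes H: "bounded_measurable config_space H" "\<And>\<omega>. \<omega> \<in> configurations \<Longrightarrow> H (\<omega> \<inter> E) = H \<omega>"
    and s: "s \<in> configurations"
  shows "(avg ^^ k) H (s \<inter> E) = (avg ^^ k) H s"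
  using s
proof (induction k arbitrary: s)
  case 0
  then show ?case using H(2) by simp
next
  case (Suc k)
  have sE: "s \<inter> E \<in> configurations" using Suc.prems by (rule configurations_subset) auto
  have "(avg ^^ k) H (add_point y (s \<inter> E)) = (avg ^^ k) H (add_point y s)" if "y \<in> space M" for y
  proof -
    have "add_point y (s \<inter> E) = add_point y s \<inter> E" by (auto simp: add_point_def)
    then show ?thesis using Suc.IH[of "add_point y s"] act_space[of y s] that Suc.prems by simp
  qed
  then show ?case
    unfolding funpow.simps o_apply avg_def by (intro Bochner_Integration.integral_cong refl)
qed

text \<open>After clearing \<open>E\<close>, a functional local to \<open>E\<close> sees only the
  new points, so its average is the same from every starting configuration.\<close>

lemma poisson_avg_diff_config:
  assumes H: "bounded_measurable config_space H" "\<And>\<omega>. \<omega> \<in> configurations \<Longrightarrow> H (\<omega> \<inter> E) = H \<omega>"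
    and s: "s \<in> configurations"
  shows "poisson_avg l H (s - E) = poisson_avg l H {}"
proof -
  have "(s - E) \<inter> E = {}" by auto
  then have "(avg ^^ k) H (s - E) = (avg ^^ k) H {}" for k
    using avg_pow_restrict[OF H, of "s - E" k] s by simp
  then show ?thesis by (simp add: poisson_avg_def)
qed

text \<open>New points lie in \<open>E\<close>, so a move never changes whether the disjoint set
  \<open>D\<close> is empty, and the indicator is a constant along the walk.\<close>

lemma avg_pow_void_mult:
  assumes D: "D \<in> sets borel" "D \<inter> E = {}" and h: "bounded_measurable config_space h"
    and s: "s \<in> configurations"
  shows "(avg ^^ k) (\<lambda>\<omega>. indicator (void_event D) \<omega> * h \<omega>) s = indicator (void_event D) s * (avg ^^ k) h s"
  using s
proof (induction k arbitrary: s)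
  case (Suc k)
  have "(avg ^^ Suc k) (\<lambda>\<omega>. indicator (void_event D) \<omega> * h \<omega>) s
      = (\<integral>y. indicator (void_event D) (add_point y s) * (avg ^^ k) h (add_point y s) \<partial>M)"
    unfolding funpow.simps o_apply avg_def[of _ s]
    using Suc.prems act_space by (intro Bochner_Integration.integral_cong refl Suc.IH) simp
  also have "\<dots> = (\<integral>y. indicator (void_event D) s * (avg ^^ k) h (add_point y s) \<partial>M)"
  proof (intro Bochner_Integration.integral_cong refl)
    fix y assume y: "y \<in> space M"
    have "add_point y s \<in> void_event D \<longleftrightarrow> s \<in> void_event D"
      using act_space[OF y, of s] Suc.prems D(2) by (auto simp: void_event_def add_point_def)
    then show "indicator (void_event D) (add_point y s) * (avg ^^ k) h (add_point y s)
        = indicator (void_event D) s * (avg ^^ k) h (add_point y s)"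
      by (simp add: indicator_def)
  qed
  finally show ?case by (simp add: avg_def[of _ s])
qed simp

lemma poisson_avg_void_mult:
  assumes "D \<in> sets borel" "D \<inter> E = {}" "bounded_measurable config_space h" "s \<in> configurations"
  shows "poisson_avg l (\<lambda>\<omega>. indicator (void_event D) \<omega> * h \<omega>) s = indicator (void_event D) s * poisson_avg l h s"
  unfolding poisson_avg_def avg_pow_void_mult[OF assms] by simp

end

section \<open>The law conditioned on having no points outside \<open>B\<close>\<close>

locale poisson_config_within = poisson_config +
  fixes B :: "'a set"
  assumes B_sets [measurable]: "B \<in> sets borel"
    and void_pos: "0 < prob (void_event (- B))"
begin

definition Q :: "'a set measure" where
  "Q = uniform_measure P (void_event (- B))"

lemma sets_Q [measurable_cong]: "sets Q = sets config_space"
  by (simp add: Q_def sets_P)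

lemma space_Q: "space Q = configurations"
  using sets_eq_imp_space_eq[OF sets_Q] by simp

sublocale Q: prob_space Q
  unfolding Q_def using void_pos by (intro prob_space_uniform_measure) (auto simp: emeasure_eq_measure)

lemma Q_void: "AE \<omega> in Q. \<omega> \<subseteq> B"
proof -
  have "AE \<omega> in Q. \<omega> \<in> void_event (- B)"
    unfolding Q_def by (rule AE_uniform_measureI) (auto simp: sets_P)
  then show ?thesis by eventually_elim (auto simp: void_event_def)
qed

lemma AE_Q: "AE \<omega> in P. R \<omega> \<Longrightarrow> AE \<omega> in Q. R \<omega>"
  unfolding Q_def by (rule AE_uniform_measureI) (auto simp: sets_P)

lemma integral_Q:
  assumes h: "bounded_measurable config_space h"
  shows "Q.expectation h = expectation (\<lambda>\<omega>. indicator (void_event (- B)) \<omega> * h \<omega>) / prob (void_event (- B))"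
proof -
  let ?A = "void_event (- B)"
  have [measurable]: "h \<in> borel_measurable config_space" using h by (rule bounded_measurableD)
  have "Q = density P (\<lambda>\<omega>. ennreal (indicator ?A \<omega> / prob ?A))"
    unfolding Q_def uniform_measure_def using void_pos
    by (intro arg_cong2[where f = density] refl ext)
      (auto simp: emeasure_eq_measure divide_ennreal ennreal_1[symmetric] simp del: ennreal_1 split: split_indicator)
  also have "integral\<^sup>L \<dots> h = expectation (\<lambda>\<omega>. (indicator ?A \<omega> / prob ?A) *\<^sub>R h \<omega>)"
    by (intro integral_density) auto
  also have "\<dots> = expectation (\<lambda>\<omega>. (indicator ?A \<omega> * h \<omega>) / prob ?A)" by simp
  also have "\<dots> = expectation (\<lambda>\<omega>. indicator ?A \<omega> * h \<omega>) / prob ?A"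
    by (rule integral_divide_zero)
  finally show ?thesis .
qed

end

locale poisson_config_within_on = poisson_config_within P \<nu> B + poisson_config_on P \<nu> M E l
  for P :: "'a::metric_space set measure" and \<nu> and B and M :: "'a measure" and E l +
  assumes E_subset: "E \<subseteq> B"
begin

lemma bounded_measurable_poisson_avg:
  assumes h: "bounded_measurable config_space h"
  shows "bounded_measurable config_space (poisson_avg l h)"
proof -
  obtain b where b: "\<And>s. s \<in> space config_space \<Longrightarrow> \<bar>h s\<bar> \<le> b"
    using h by (metis bounded_measurable_bound)
  have [measurable]: "(avg ^^ k) h \<in> borel_measurable config_space" for k
    using h by (intro bounded_measurableD bounded_measurable_avg_pow)
  have eq: "poisson_avg l h s = (\<Sum>k. l ^ k / fact k * exp (- l) * (avg ^^ k) h s)" if "s \<in> configurations" for s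
    unfolding poisson_avg_def using h b that l_nonneg
    by (intro expectation_poisson_pmf0[where B = b] avg_pow_abs_le) auto
  have "(\<lambda>s. \<Sum>k. l ^ k / fact k * exp (- l) * (avg ^^ k) h s) \<in> borel_measurable config_space"
    by measurable
  then have "poisson_avg l h \<in> borel_measurable config_space"
    by (rule iffD2[OF measurable_cong, rotated]) (simp add: eq)
  moreover have "\<bar>poisson_avg l h s\<bar> \<le> b" if s: "s \<in> space config_space" for s
  proof -
    have "\<bar>poisson_avg l h s\<bar> \<le> poisson_avg l (\<lambda>_. b) s"
      using poisson_avg_mono[of h "\<lambda>_. b" s l] poisson_avg_mono[of "\<lambda>_. - b" h s l] h b s
      by (auto simp: poisson_avg_const abs_le_iff minus_le_iff)
    then show ?thesis by (simp add: poisson_avg_const)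
  qed
  ultimately show ?thesis by (rule bounded_measurableI)
qed

lemma bounded_measurable_poisson_avg_diff:
  assumes h: "bounded_measurable config_space h"
  shows "bounded_measurable config_space (\<lambda>\<omega>. poisson_avg l h (\<omega> - E))"
  using bounded_measurable_compose[OF bounded_measurable_poisson_avg[OF h] measurable_diff_config[OF E_sets]] .

text \<open>Since \<open>E \<subseteq> B\<close>, clearing and refilling \<open>E\<close> does not
  touch the complement of \<open>B\<close>. The conditioning indicator therefore factors out of the
  invariance of \<open>P\<close>, and \<open>Q\<close> inherits it.\<close>

lemma Q_resample:
  assumes h: "bounded_measurable config_space h"
  shows "Q.expectation h = Q.expectation (\<lambda>\<omega>. poisson_avg l h (\<omega> - E))"
proof -
  let ?A = "void_event (- B)"
  have D: "- B \<in> sets borel" "- B \<inter> E = {}" using E_subset by auto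
  have "bounded_measurable config_space (\<lambda>\<omega>. indicator ?A \<omega> * h \<omega>)"
    using h by (intro bounded_measurable_mult bounded_measurable_indicator) auto
  then have "expectation (\<lambda>\<omega>. indicator ?A \<omega> * h \<omega>)
      = expectation (\<lambda>\<omega>. poisson_avg l (\<lambda>\<omega>. indicator ?A \<omega> * h \<omega>) (\<omega> - E))"
    by (rule expectation_resample)
  also have "\<dots> = expectation (\<lambda>\<omega>. indicator ?A \<omega> * poisson_avg l h (\<omega> - E))"
  proof (intro Bochner_Integration.integral_cong refl)
    fix \<omega> assume "\<omega> \<in> space P"
    then have w: "\<omega> \<in> configurations" by (simp add: space_P)
    then have "poisson_avg l (\<lambda>\<omega>. indicator ?A \<omega> * h \<omega>) (\<omega> - E) = indicator ?A (\<omega> - E) * poisson_avg l h (\<omega> - E)"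
      by (intro poisson_avg_void_mult D h) simp
    moreover have "\<omega> - E \<in> ?A \<longleftrightarrow> \<omega> \<in> ?A" using E_subset w by (auto simp: void_event_def)
    ultimately show "poisson_avg l (\<lambda>\<omega>. indicator ?A \<omega> * h \<omega>) (\<omega> - E) = indicator ?A \<omega> * poisson_avg l h (\<omega> - E)"
      by (simp add: indicator_def)
  qed
  finally show ?thesis
    using h by (simp add: integral_Q bounded_measurable_poisson_avg_diff)
qed

text \<open>The energy controls the randomness inside \<open>E\<close>; what remains is the variance of the
  conditional mean given the points outside \<open>E\<close>, small if \<open>h\<close> is close to a functional of the
  points inside \<open>E\<close>.\<close>

lemma Q_variance_le:
  assumes h: "bounded_measurable config_space h" and H: "bounded_measurable config_space H"
    and loc: "\<And>\<omega>. \<omega> \<in> configurations \<Longrightarrow> H (\<omega> \<inter> E) = H \<omega>"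
    and b: "\<And>\<omega>. \<omega> \<in> configurations \<Longrightarrow> \<bar>h \<omega>\<bar> \<le> b" "\<And>\<omega>. \<omega> \<in> configurations \<Longrightarrow> \<bar>H \<omega>\<bar> \<le> b"
  shows "Q.variance h \<le> Q.expectation (\<lambda>\<omega>. l * energy h \<omega>) + 2 * b * Q.expectation (\<lambda>\<omega>. \<bar>h \<omega> - H \<omega>\<bar>)"
proof -
  define Z where "Z = (\<lambda>\<omega>. poisson_avg l h (\<omega> - E))"
  define c where "c = poisson_avg l H {}"
  have bmQ: "integrable Q f" if "bounded_measurable config_space f" for f
    using that by (intro Q.integrable_bounded_measurable)
      (simp add: bounded_measurable_def space_Q sets_Q cong: measurable_cong_sets)
  have Z: "bounded_measurable config_space Z"
    unfolding Z_def by (rule bounded_measurable_poisson_avg_diff[OF h])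
  have hH: "bounded_measurable config_space (\<lambda>\<omega>. \<bar>h \<omega> - H \<omega>\<bar>)"
    using h H by auto
  have e: "bounded_measurable config_space (\<lambda>\<omega>. l * energy h \<omega>)"
    using h by (intro bounded_measurable_mult) auto
  have b0: "0 \<le> b" using b(1)[of "{}"] by (simp add: configurations_iff)
  have EZ: "Q.expectation Z = Q.expectation h"
    unfolding Z_def using Q_resample[OF h] by simp
  have "Q.expectation (\<lambda>\<omega>. (h \<omega>)\<^sup>2) = Q.expectation (\<lambda>\<omega>. poisson_avg l (\<lambda>\<omega>. (h \<omega>)\<^sup>2) (\<omega> - E))"
    using h by (intro Q_resample) auto
  \<comment> \<open>The walk inequality is applied from the state \<open>\<omega> - E\<close>; by
    invariance of \<open>Q\<close>, its energy term later integrates to the expectation of the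
    energy itself.\<close>
  also have "\<dots> \<le> Q.expectation (\<lambda>\<omega>. (Z \<omega>)\<^sup>2 + poisson_avg l (\<lambda>\<omega>. l * energy h \<omega>) (\<omega> - E))"
  proof (rule integral_mono)
    show "integrable Q (\<lambda>\<omega>. poisson_avg l (\<lambda>\<omega>. (h \<omega>)\<^sup>2) (\<omega> - E))"
      using h by (intro bmQ bounded_measurable_poisson_avg_diff) auto
    show "integrable Q (\<lambda>\<omega>. (Z \<omega>)\<^sup>2 + poisson_avg l (\<lambda>\<omega>. l * energy h \<omega>) (\<omega> - E))"
      using Z e by (intro bmQ bounded_measurable_add bounded_measurable_poisson_avg_diff) auto
    fix \<omega> assume "\<omega> \<in> space Q"
    then have w: "\<omega> - E \<in> space config_space" by (simp add: space_Q)
    have "poisson_avg l (\<lambda>\<omega>. l * energy h \<omega>) (\<omega> - E) = l * poisson_avg l (energy h) (\<omega> - E)"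
      using poisson_avg_lin[OF bounded_measurable_energy[OF h] bounded_measurable_const w, of l l 0 0] by simp
    then show "poisson_avg l (\<lambda>\<omega>. (h \<omega>)\<^sup>2) (\<omega> - E) \<le> (Z \<omega>)\<^sup>2 + poisson_avg l (\<lambda>\<omega>. l * energy h \<omega>) (\<omega> - E)"
      using poisson_variance_le[OF l_nonneg h w] by (simp add: Z_def)
  qed
  also have "\<dots> = Q.expectation (\<lambda>\<omega>. (Z \<omega>)\<^sup>2) + Q.expectation (\<lambda>\<omega>. l * energy h \<omega>)"
    using Z e Q_resample[OF e]
    by (subst Bochner_Integration.integral_add) (auto intro!: bmQ bounded_measurable_poisson_avg_diff)
  finally have 1: "Q.expectation (\<lambda>\<omega>. (h \<omega>)\<^sup>2) \<le> Q.expectation (\<lambda>\<omega>. (Z \<omega>)\<^sup>2) + Q.expectation (\<lambda>\<omega>. l * energy h \<omega>)" .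
  \<comment> \<open>The mean minimises the mean square distance, so any other constant gives an
    upper bound; \<open>c\<close> is the value \<open>Z\<close> would have with \<open>H\<close> in
    place of \<open>h\<close>.\<close>
  have "Q.expectation (\<lambda>\<omega>. (Z \<omega>)\<^sup>2) - (Q.expectation Z)\<^sup>2 \<le> Q.expectation (\<lambda>\<omega>. (Z \<omega> - c)\<^sup>2)"
  proof -
    have "Q.expectation (\<lambda>\<omega>. (Z \<omega> - c)\<^sup>2) = Q.expectation (\<lambda>\<omega>. (Z \<omega>)\<^sup>2 - 2 * c * Z \<omega> + c\<^sup>2)"
      by (simp add: power2_eq_square algebra_simps)
    also have "\<dots> = Q.expectation (\<lambda>\<omega>. (Z \<omega>)\<^sup>2) - 2 * c * Q.expectation Z + c\<^sup>2"
      using bmQ[OF Z] bmQ[OF bounded_measurable_power2[OF Z]] by (simp add: Q.prob_space)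
    finally show ?thesis
      using zero_le_power2[of "Q.expectation Z - c"] by (simp add: power2_eq_square algebra_simps)
  qed
  also have "\<dots> \<le> Q.expectation (\<lambda>\<omega>. 2 * b * poisson_avg l (\<lambda>\<omega>. \<bar>h \<omega> - H \<omega>\<bar>) (\<omega> - E))"
  proof (rule integral_mono)
    show "integrable Q (\<lambda>\<omega>. (Z \<omega> - c)\<^sup>2)"
      using Z by (intro bmQ bounded_measurable_power2 bounded_measurable_diff bounded_measurable_const)
    show "integrable Q (\<lambda>\<omega>. 2 * b * poisson_avg l (\<lambda>\<omega>. \<bar>h \<omega> - H \<omega>\<bar>) (\<omega> - E))"
      using hH by (intro bmQ bounded_measurable_mult bounded_measurable_poisson_avg_diff) auto
    fix \<omega> assume "\<omega> \<in> space Q"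
    then have w': "\<omega> \<in> configurations" and w: "\<omega> - E \<in> space config_space" by (simp_all add: space_Q)
    have cw: "c = poisson_avg l H (\<omega> - E)"
      unfolding c_def using poisson_avg_diff_config[OF H loc w'] by simp
    then have Zc: "Z \<omega> - c = poisson_avg l (\<lambda>\<omega>. 1 * h \<omega> + (- 1) * H \<omega>) (\<omega> - E)"
      unfolding Z_def using poisson_avg_lin[OF h H w, of l 1 "- 1"] by simp
    have d: "bounded_measurable config_space (\<lambda>\<omega>. 1 * h \<omega> + (- 1) * H \<omega>)"
      using h H by (intro bounded_measurable_add bounded_measurable_mult) auto
    have "Z \<omega> - c \<le> poisson_avg l (\<lambda>\<omega>. \<bar>h \<omega> - H \<omega>\<bar>) (\<omega> - E)"
      unfolding Zc using d hH w by (intro poisson_avg_mono) auto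
    moreover have "- (Z \<omega> - c) \<le> poisson_avg l (\<lambda>\<omega>. \<bar>h \<omega> - H \<omega>\<bar>) (\<omega> - E)"
    proof -
      have "- (Z \<omega> - c) = poisson_avg l (\<lambda>\<omega>. 1 * H \<omega> + (- 1) * h \<omega>) (\<omega> - E)"
        using cw poisson_avg_lin[OF H h w, of l 1 "- 1"] by (simp add: Z_def)
      also have "\<dots> \<le> poisson_avg l (\<lambda>\<omega>. \<bar>h \<omega> - H \<omega>\<bar>) (\<omega> - E)"
        using h H hH w by (intro poisson_avg_mono bounded_measurable_add bounded_measurable_mult) auto
      finally show ?thesis .
    qed
    ultimately have 1: "\<bar>Z \<omega> - c\<bar> \<le> poisson_avg l (\<lambda>\<omega>. \<bar>h \<omega> - H \<omega>\<bar>) (\<omega> - E)" by linarith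
    also have "\<dots> \<le> poisson_avg l (\<lambda>_. 2 * b) (\<omega> - E)"
    proof (intro poisson_avg_mono hH bounded_measurable_const w)
      show "\<bar>h s - H s\<bar> \<le> 2 * b" if "s \<in> space config_space" for s
        using b[of s] that by auto
    qed
    finally have 2: "\<bar>Z \<omega> - c\<bar> \<le> 2 * b" by (simp add: poisson_avg_const)
    \<comment> \<open>One factor is bounded by \<open>2 * b\<close>, so that approximation in mean,
      rather than in mean square, suffices.\<close>
    have "(Z \<omega> - c)\<^sup>2 = \<bar>Z \<omega> - c\<bar> * \<bar>Z \<omega> - c\<bar>" by (simp add: power2_eq_square)
    also have "\<dots> \<le> 2 * b * poisson_avg l (\<lambda>\<omega>. \<bar>h \<omega> - H \<omega>\<bar>) (\<omega> - E)"
      using 1 2 b0 by (intro mult_mono) auto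
    finally show "(Z \<omega> - c)\<^sup>2 \<le> 2 * b * poisson_avg l (\<lambda>\<omega>. \<bar>h \<omega> - H \<omega>\<bar>) (\<omega> - E)" .
  qed
  also have "\<dots> = 2 * b * Q.expectation (\<lambda>\<omega>. \<bar>h \<omega> - H \<omega>\<bar>)"
    using Q_resample[OF hH] by simp
  finally have "Q.expectation (\<lambda>\<omega>. (Z \<omega>)\<^sup>2) - (Q.expectation Z)\<^sup>2 \<le> 2 * b * Q.expectation (\<lambda>\<omega>. \<bar>h \<omega> - H \<omega>\<bar>)" .
  moreover have "Q.variance h = Q.expectation (\<lambda>\<omega>. (h \<omega>)\<^sup>2) - (Q.expectation h)\<^sup>2"
    using h by (intro Q.variance_eq bmQ) auto
  ultimately show ?thesis using 1 EZ by simp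
qed

end

section \<open>Approximation by local functionals\<close>

context poisson_config_within
begin

lemma integrable_Q: "bounded_measurable config_space h \<Longrightarrow> integrable Q h"
  by (intro Q.integrable_bounded_measurable)
    (simp add: bounded_measurable_def space_Q sets_Q cong: measurable_cong_sets)

text \<open>The \<open>L1\<close> closure, under \<open>Q\<close>, of the functionals that see only
  the points in some \<open>E n\<close>.\<close>

definition approximable :: "(nat \<Rightarrow> 'a set) \<Rightarrow> ('a set \<Rightarrow> real) \<Rightarrow> bool" where
  "approximable E f \<longleftrightarrow> (\<forall>e>0. \<exists>n H. bounded_measurable config_space H \<and>
     (\<forall>\<omega>\<in>configurations. H (\<omega> \<inter> E n) = H \<omega>) \<and> Q.expectation (\<lambda>\<omega>. \<bar>f \<omega> - H \<omega>\<bar>) < e)"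

lemma approximableD:
  assumes "approximable E f" "0 < e"
  obtains n H where "bounded_measurable config_space H"
    "\<And>\<omega>. \<omega> \<in> configurations \<Longrightarrow> H (\<omega> \<inter> E n) = H \<omega>" "Q.expectation (\<lambda>\<omega>. \<bar>f \<omega> - H \<omega>\<bar>) < e"
proof -
  obtain n H where "bounded_measurable config_space H \<and> (\<forall>\<omega>\<in>configurations. H (\<omega> \<inter> E n) = H \<omega>) \<and>
      Q.expectation (\<lambda>\<omega>. \<bar>f \<omega> - H \<omega>\<bar>) < e"
    using assms(1)[unfolded approximable_def, THEN spec, THEN mp, OF assms(2)] by (elim exE)
  then show ?thesis by (elim conjE) (rule that, auto)
qed

lemma approximable_self:
  assumes "bounded_measurable config_space H" "\<And>\<omega>. \<omega> \<in> configurations \<Longrightarrow> H (\<omega> \<inter> E n) = H \<omega>"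
  shows "approximable E H"
  unfolding approximable_def
  by (intro allI impI exI[of _ n] exI[of _ H] conjI ballI) (simp_all only: assms diff_self abs_zero integral_zero)

lemma local_mono:
  assumes "incseq E" "n \<le> N" "\<And>\<omega>. \<omega> \<in> configurations \<Longrightarrow> H (\<omega> \<inter> E n) = H \<omega>" "\<omega> \<in> configurations"
  shows "H (\<omega> \<inter> E N) = H \<omega>"
proof -
  have "\<omega> \<inter> E N \<in> configurations" using assms(4) by (rule configurations_subset) auto
  then have "H (\<omega> \<inter> E N) = H (\<omega> \<inter> E N \<inter> E n)" using assms(3) by metis
  also have "\<omega> \<inter> E N \<inter> E n = \<omega> \<inter> E n" using assms(1,2) by (auto dest: incseqD)
  finally show ?thesis using assms(3,4) by simp
qed

lemma approximable_lin:
  assumes E: "incseq E" and f: "integrable Q f" "approximable E f" and g: "integrable Q g" "approximable E g"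
  shows "approximable E (\<lambda>\<omega>. a * f \<omega> + b * g \<omega>)"
  unfolding approximable_def
proof (intro allI impI)
  fix e :: real assume e: "0 < e"
  \<comment> \<open>The 1 in the denominators admits vanishing coefficients and makes each
    contribution strictly less than \<open>e / 2\<close>.\<close>
  have pos: "0 < e / (2 * (\<bar>a\<bar> + 1))" "0 < e / (2 * (\<bar>b\<bar> + 1))" using e by auto
  obtain n H where
    H: "bounded_measurable config_space H" "\<And>\<omega>. \<omega> \<in> configurations \<Longrightarrow> H (\<omega> \<inter> E n) = H \<omega>"
      "Q.expectation (\<lambda>\<omega>. \<bar>f \<omega> - H \<omega>\<bar>) < e / (2 * (\<bar>a\<bar> + 1))"
    using f(2) pos(1) by (rule approximableD) (rule that)
  obtain k K where
    K: "bounded_measurable config_space K" "\<And>\<omega>. \<omega> \<in> configurations \<Longrightarrow> K (\<omega> \<inter> E k) = K \<omega>"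
      "Q.expectation (\<lambda>\<omega>. \<bar>g \<omega> - K \<omega>\<bar>) < e / (2 * (\<bar>b\<bar> + 1))"
    using g(2) pos(2) by (rule approximableD) (rule that)
  let ?L = "\<lambda>\<omega>. a * H \<omega> + b * K \<omega>"
  have L: "bounded_measurable config_space ?L"
    using H(1) K(1) by (intro bounded_measurable_add bounded_measurable_mult) auto
  have "?L (\<omega> \<inter> E (max n k)) = ?L \<omega>" if "\<omega> \<in> configurations" for \<omega>
    using local_mono[where H = H and n = n, OF E max.cobounded1[of n k] H(2) that]
      local_mono[where H = K and n = k, OF E max.cobounded2[of k n] K(2) that] by simp
  moreover have "Q.expectation (\<lambda>\<omega>. \<bar>a * f \<omega> + b * g \<omega> - ?L \<omega>\<bar>) < e"
  proof -
    have i: "integrable Q (\<lambda>\<omega>. \<bar>f \<omega> - H \<omega>\<bar>)" "integrable Q (\<lambda>\<omega>. \<bar>g \<omega> - K \<omega>\<bar>)"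
      using f(1) g(1) integrable_Q[OF H(1)] integrable_Q[OF K(1)] by auto
    have "Q.expectation (\<lambda>\<omega>. \<bar>a * f \<omega> + b * g \<omega> - ?L \<omega>\<bar>)
        \<le> Q.expectation (\<lambda>\<omega>. \<bar>a\<bar> * \<bar>f \<omega> - H \<omega>\<bar> + \<bar>b\<bar> * \<bar>g \<omega> - K \<omega>\<bar>)"
    proof (rule integral_mono)
      show "integrable Q (\<lambda>\<omega>. \<bar>a * f \<omega> + b * g \<omega> - ?L \<omega>\<bar>)"
        using f(1) g(1) integrable_Q[OF H(1)] integrable_Q[OF K(1)] by auto
      show "integrable Q (\<lambda>\<omega>. \<bar>a\<bar> * \<bar>f \<omega> - H \<omega>\<bar> + \<bar>b\<bar> * \<bar>g \<omega> - K \<omega>\<bar>)" using i by auto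
      fix \<omega>
      have "a * f \<omega> + b * g \<omega> - ?L \<omega> = a * (f \<omega> - H \<omega>) + b * (g \<omega> - K \<omega>)"
        by (simp add: algebra_simps)
      then show "\<bar>a * f \<omega> + b * g \<omega> - ?L \<omega>\<bar> \<le> \<bar>a\<bar> * \<bar>f \<omega> - H \<omega>\<bar> + \<bar>b\<bar> * \<bar>g \<omega> - K \<omega>\<bar>"
        using abs_triangle_ineq[of "a * (f \<omega> - H \<omega>)" "b * (g \<omega> - K \<omega>)"] by (simp add: abs_mult)
    qed
    also have "\<dots> = \<bar>a\<bar> * Q.expectation (\<lambda>\<omega>. \<bar>f \<omega> - H \<omega>\<bar>) + \<bar>b\<bar> * Q.expectation (\<lambda>\<omega>. \<bar>g \<omega> - K \<omega>\<bar>)"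
      using i by simp
    also have "\<dots> \<le> \<bar>a\<bar> * (e / (2 * (\<bar>a\<bar> + 1))) + \<bar>b\<bar> * (e / (2 * (\<bar>b\<bar> + 1)))"
      using H(3) K(3) by (intro add_mono mult_left_mono) auto
    also have "\<dots> < e / 2 + e / 2"
      using e by (intro add_strict_mono) (auto simp: field_simps)
    finally show ?thesis by simp
  qed
  ultimately show "\<exists>n H. bounded_measurable config_space H \<and>
     (\<forall>\<omega>\<in>configurations. H (\<omega> \<inter> E n) = H \<omega>) \<and> Q.expectation (\<lambda>\<omega>. \<bar>a * f \<omega> + b * g \<omega> - H \<omega>\<bar>) < e"
    using L by blast
qed

lemma approximable_lim:
  assumes s: "\<And>i. integrable Q (s i)" "\<And>i. approximable E (s i)"
    and f: "integrable Q f" and w: "integrable Q w" "\<And>i. AE \<omega> in Q. \<bar>s i \<omega>\<bar> \<le> w \<omega>"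
    and lim: "AE \<omega> in Q. (\<lambda>i. s i \<omega>) \<longlonglongrightarrow> f \<omega>"
  shows "approximable E f"
  unfolding approximable_def
proof (intro allI impI)
  fix e :: real assume e: "0 < e"
  have "(\<lambda>i. Q.expectation (\<lambda>\<omega>. \<bar>f \<omega> - s i \<omega>\<bar>)) \<longlonglongrightarrow> Q.expectation (\<lambda>\<omega>. 0)"
  proof (rule integral_dominated_convergence)
    show "integrable Q (\<lambda>\<omega>. \<bar>f \<omega>\<bar> + w \<omega>)" using f w by auto
    show "(\<lambda>\<omega>. \<bar>f \<omega> - s i \<omega>\<bar>) \<in> borel_measurable Q" for i
      using f s(1)[of i] by auto
    show "AE \<omega> in Q. (\<lambda>i. \<bar>f \<omega> - s i \<omega>\<bar>) \<longlonglongrightarrow> 0"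
      using lim
    proof eventually_elim
      case (elim \<omega>)
      from tendsto_diff[OF tendsto_const[of "f \<omega>"] elim] show ?case
        by (intro tendsto_rabs_zero) simp
    qed
    show "AE \<omega> in Q. norm \<bar>f \<omega> - s i \<omega>\<bar> \<le> \<bar>f \<omega>\<bar> + w \<omega>" for i
      using w(2)[of i] by eventually_elim auto
  qed simp
  then have "\<forall>\<^sub>F i in sequentially. Q.expectation (\<lambda>\<omega>. \<bar>f \<omega> - s i \<omega>\<bar>) < e / 2"
    using e by (intro order_tendstoD) auto
  then obtain i where i: "Q.expectation (\<lambda>\<omega>. \<bar>f \<omega> - s i \<omega>\<bar>) < e / 2"
    by (auto simp: eventually_sequentially)
  obtain n H where H: "bounded_measurable config_space H" "\<And>\<omega>. \<omega> \<in> configurations \<Longrightarrow> H (\<omega> \<inter> E n) = H \<omega>"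
      "Q.expectation (\<lambda>\<omega>. \<bar>s i \<omega> - H \<omega>\<bar>) < e / 2"
    using s(2) half_gt_zero[OF e] by (rule approximableD) (rule that)
  have int: "integrable Q (\<lambda>\<omega>. \<bar>f \<omega> - s i \<omega>\<bar>)" "integrable Q (\<lambda>\<omega>. \<bar>s i \<omega> - H \<omega>\<bar>)"
    "integrable Q (\<lambda>\<omega>. \<bar>f \<omega> - H \<omega>\<bar>)"
    using f s(1)[of i] integrable_Q[OF H(1)] by auto
  have "Q.expectation (\<lambda>\<omega>. \<bar>f \<omega> - H \<omega>\<bar>) \<le> Q.expectation (\<lambda>\<omega>. \<bar>f \<omega> - s i \<omega>\<bar> + \<bar>s i \<omega> - H \<omega>\<bar>)"
    using int by (intro integral_mono) auto
  also have "\<dots> = Q.expectation (\<lambda>\<omega>. \<bar>f \<omega> - s i \<omega>\<bar>) + Q.expectation (\<lambda>\<omega>. \<bar>s i \<omega> - H \<omega>\<bar>)"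
    using int by simp
  also have "\<dots> < e" using i H(3) by simp
  finally show "\<exists>n H. bounded_measurable config_space H \<and>
     (\<forall>\<omega>\<in>configurations. H (\<omega> \<inter> E n) = H \<omega>) \<and> Q.expectation (\<lambda>\<omega>. \<bar>f \<omega> - H \<omega>\<bar>) < e"
    using H by blast
qed

text \<open>Under \<open>Q\<close> all points lie in \<open>B\<close>, so a point in
  \<open>A\<close> lies in some \<open>E n\<close> as well; the indicators for
  \<open>A \<inter> E n\<close> are then eventually equal to the one for \<open>A\<close>.\<close>

lemma approximable_void_event:
  assumes E: "incseq E" "\<And>n. E n \<in> sets borel" "(\<Union>n. E n) = B" and A: "A \<in> sets borel"
  shows "approximable E (indicator (void_event A))"
proof (rule approximable_lim[where s = "\<lambda>n. indicator (void_event (A \<inter> E n))" and w = "\<lambda>_. 1"])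
  show "integrable Q (indicator (void_event (A \<inter> E n)) :: _ \<Rightarrow> real)" for n
    using E(2) A by (intro integrable_Q bounded_measurable_indicator) auto
  show "integrable Q (indicator (void_event A) :: _ \<Rightarrow> real)"
    using A by (intro integrable_Q bounded_measurable_indicator) auto
  show "approximable E (indicator (void_event (A \<inter> E n)))" for n
  proof (rule approximable_self[where n = n])
    show "bounded_measurable config_space (indicator (void_event (A \<inter> E n)))"
      using E(2) A by (intro bounded_measurable_indicator) auto
    show "indicator (void_event (A \<inter> E n)) (\<omega> \<inter> E n) = (indicator (void_event (A \<inter> E n)) \<omega> :: real)"
      if "\<omega> \<in> configurations" for \<omega>
      using that configurations_subset[OF that, of "\<omega> \<inter> E n"]
      by (auto simp: indicator_def void_event_def)
  qed
  show "AE \<omega> in Q. (\<lambda>n. indicator (void_event (A \<inter> E n)) \<omega> :: real) \<longlonglongrightarrow> indicator (void_event A) \<omega>"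
    using Q_void AE_space
  proof eventually_elim
    case (elim \<omega>)
    then have w: "\<omega> \<in> configurations" by (simp add: space_Q)
    show ?case
    proof (cases "\<omega> \<inter> A = {}")
      case True
      then have "\<omega> \<in> void_event A" "\<And>n. \<omega> \<in> void_event (A \<inter> E n)" using w by (auto simp: void_event_def)
      then show ?thesis by simp
    next
      case False
      then obtain y n where y: "y \<in> \<omega>" "y \<in> A" "y \<in> E n" using elim(1) E(3) by blast
      have "\<omega> \<notin> void_event (A \<inter> E k)" if "n \<le> k" for k
        using y E(1) that by (auto simp: void_event_def dest: incseqD)
      then have "\<forall>\<^sub>F k in sequentially. (indicator (void_event (A \<inter> E k)) \<omega> :: real) = indicator (void_event A) \<omega>"
        using False by (intro eventually_sequentiallyI[of n]) (auto simp: void_event_def indicator_def)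
      then show ?thesis by (rule tendsto_eventually)
    qed
  qed
qed (auto split: split_indicator)

text \<open>Dynkin's argument from the intersection-stable void events: linearity gives complements
  and finite disjoint unions, dominated convergence the countable ones.\<close>

lemma approximable_indicator:
  assumes E: "incseq E" "\<And>n. E n \<in> sets borel" "(\<Union>n. E n) = B" and S: "S \<in> sets config_space"
  shows "approximable E (indicator S)"
proof -
  note eq = sets_config_space_eq[OF sigma_compact_UNIV radon]
  have int: "integrable Q (indicator S :: _ \<Rightarrow> real)" if "S \<in> sets config_space" for S
    using that by (intro integrable_Q bounded_measurable_indicator)
  have sub: "void_events \<nu> \<subseteq> Pow configurations"
    by (auto simp: void_events_def void_event_def)
  have "S \<in> sigma_sets configurations (void_events \<nu>)" using S eq by simp
  with void_events_Int_stable[OF sets_nu] sub show ?thesis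
  proof (induction rule: sigma_sets_induct_disjoint)
    case (basic S)
    then show ?case using approximable_void_event[OF E] by (auto simp: void_events_def)
  next
    case empty
    have "approximable E (\<lambda>_. 0)" by (rule approximable_self[where n = 0]) auto
    then show ?case by simp
  next
    case (compl S)
    have "approximable E (\<lambda>_. 1)" by (rule approximable_self[where n = 0]) auto
    then have *: "approximable E (\<lambda>\<omega>. 1 * 1 + (- 1) * indicator S \<omega>)"
      using compl int[of S] eq by (intro approximable_lin E) auto
    show ?case
      unfolding approximable_def
    proof (intro allI impI)
      fix e :: real assume "0 < e"
      with * obtain n H where
        H: "bounded_measurable config_space H" "\<And>\<omega>. \<omega> \<in> configurations \<Longrightarrow> H (\<omega> \<inter> E n) = H \<omega>"
        "Q.expectation (\<lambda>\<omega>. \<bar>1 * 1 + (- 1) * indicator S \<omega> - H \<omega>\<bar>) < e" by (rule approximableD) (rule that)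
      \<comment> \<open>The complement is relative to \<open>configurations\<close>, so the two
        indicators agree only on the space of \<open>Q\<close>, which is enough under the
        integral.\<close>
      have "Q.expectation (\<lambda>\<omega>. \<bar>indicator (configurations - S) \<omega> - H \<omega>\<bar>)
          = Q.expectation (\<lambda>\<omega>. \<bar>1 * 1 + (- 1) * indicator S \<omega> - H \<omega>\<bar>)"
        by (intro Bochner_Integration.integral_cong refl) (auto simp: space_Q split: split_indicator)
      then show "\<exists>n H. bounded_measurable config_space H \<and>
         (\<forall>\<omega>\<in>configurations. H (\<omega> \<inter> E n) = H \<omega>) \<and> Q.expectation (\<lambda>\<omega>. \<bar>indicator (configurations - S) \<omega> - H \<omega>\<bar>) < e"
        using H by metis
    qed
  next
    case (union S)
    have S: "S i \<in> sets config_space" for i using union(2) eq by auto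
    have U: "(\<Union>i<m. S i) \<in> sets config_space" for m using S by auto
    have "approximable E (indicator (\<Union>i<m. S i))" for m :: nat
    proof (induction m)
      case 0
      have "approximable E (\<lambda>_. 0)" by (rule approximable_self[where n = 0]) auto
      then show ?case by simp
    next
      case (Suc m)
      have "S m \<inter> (\<Union>i<m. S i) = {}"
        using union(1) by (auto simp: disjoint_family_on_def) (metis disjoint_iff less_irrefl)
      then have "(indicator (\<Union>i<Suc m. S i) :: _ \<Rightarrow> real) = (\<lambda>\<omega>. 1 * indicator (\<Union>i<m. S i) \<omega> + 1 * indicator (S m) \<omega>)"
        by (auto simp: fun_eq_iff lessThan_Suc split: split_indicator)
      moreover have "approximable E (\<lambda>\<omega>. 1 * indicator (\<Union>i<m. S i) \<omega> + 1 * indicator (S m) \<omega>)"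
        by (rule approximable_lin[OF E(1) int[OF U] Suc int[OF S] union(3)])
      ultimately show ?case by (simp only:)
    qed
    have "(\<Union>i. S i) \<in> sets config_space" using S by auto
    have "(\<lambda>m. indicator (\<Union>i<m. S i) \<omega> :: real) \<longlonglongrightarrow> indicator (\<Union>i. S i) \<omega>" for \<omega>
      by (rule LIMSEQ_indicator_UN)
    note lim = this
    show ?case
    proof (rule approximable_lim[where s = "\<lambda>m. indicator (\<Union>i<m. S i)" and w = "\<lambda>_. 1"])
      show "integrable Q (indicator (\<Union>i. S i) :: _ \<Rightarrow> real)" by (rule int) fact
      show "AE \<omega> in Q. (\<lambda>m. indicator (\<Union>i<m. S i) \<omega> :: real) \<longlonglongrightarrow> indicator (\<Union>i. S i) \<omega>"
        using lim by (rule AE_I2)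
      show "AE \<omega> in Q. \<bar>indicator (\<Union>i<m. S i) \<omega> :: real\<bar> \<le> 1" for m
        by (intro AE_I2) (simp add: indicator_def)
    qed (rule int[OF U], fact, simp)
  qed
qed

lemma approximable_integrable:
  assumes E: "incseq E" "\<And>n. E n \<in> sets borel" "(\<Union>n. E n) = B" and f: "integrable Q f"
  shows "approximable E f"
  using f
proof (induction rule: integrable_induct)
  case (base A c)
  have A: "A \<in> sets config_space" using base by (simp add: sets_Q)
  have i: "integrable Q (indicator A :: _ \<Rightarrow> real)"
    using A by (intro integrable_Q bounded_measurable_indicator)
  have "approximable E (\<lambda>\<omega>. c * indicator A \<omega> + 0 * indicator A \<omega>)"
    using approximable_indicator[OF E A] by (intro approximable_lin E(1) i)
  then show ?case by (simp add: mult.commute)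
next
  case (add f g)
  then show ?case using approximable_lin[OF E(1), of f g 1 1] by simp
next
  case (lim f s)
  show ?case
  proof (rule approximable_lim[where s = s and w = "\<lambda>\<omega>. 2 * \<bar>f \<omega>\<bar>"])
    show "integrable Q (\<lambda>\<omega>. 2 * \<bar>f \<omega>\<bar>)" using lim(4) by simp
    show "AE \<omega> in Q. \<bar>s i \<omega>\<bar> \<le> 2 * \<bar>f \<omega>\<bar>" for i using lim(3)[of _ i] by (intro AE_I2) simp
    show "AE \<omega> in Q. (\<lambda>i. s i \<omega>) \<longlonglongrightarrow> f \<omega>" using lim(2) by (intro AE_I2)
  qed fact+
qed

theorem poincare_inequality:
  assumes h: "bounded_measurable config_space h" and c: "0 \<le> c"
    and D: "AE \<omega> in Q. (\<integral>\<^sup>+y. ennreal ((h (\<omega> \<union> {y}) - h \<omega>)\<^sup>2) * indicator B y \<partial>\<nu>) \<le> ennreal c"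
  shows "Q.variance h \<le> c"
proof (rule field_le_epsilon)
  fix e :: real assume e: "0 < e"
  obtain K :: "nat \<Rightarrow> 'a set" where K: "\<And>n. compact (K n)" "(\<Union>n. K n) = UNIV"
    using sigma_compact_UNIV by (auto simp: sigma_compact_def)
  \<comment> \<open>Compact sets have finite intensity, so each \<open>E n\<close> can be
    resampled.\<close>
  define E where "E = (\<lambda>n. B \<inter> (\<Union>i\<le>n. K i))"
  have K': "compact (\<Union>i\<le>n. K i)" for n using K(1) by (intro compact_UN) auto
  have E: "incseq E" "\<And>n. E n \<in> sets borel" "(\<Union>n. E n) = B"
  proof -
    show "incseq E" unfolding E_def by (intro monoI Int_mono UN_mono) auto
    show "E n \<in> sets borel" for n unfolding E_def using K' by (intro sets.Int borel_compact B_sets)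
    show "(\<Union>n. E n) = B" unfolding E_def using K(2) by auto
  qed
  have finE: "emeasure \<nu> (E n) < \<infinity>" for n
  proof -
    have "emeasure \<nu> (E n) \<le> emeasure \<nu> (\<Union>i\<le>n. K i)"
      using K' by (intro emeasure_mono) (auto simp: E_def sets_nu borel_compact)
    also have "\<dots> < \<infinity>" using radon K' by (simp add: radon_measure_def)
    finally show ?thesis .
  qed
  obtain b where b: "0 \<le> b" "\<And>\<omega>. \<omega> \<in> configurations \<Longrightarrow> \<bar>h \<omega>\<bar> \<le> b"
    using h by (metis bounded_measurable_bound space_config_space)
  \<comment> \<open>Chosen so that \<open>2 * b\<close> times the approximation error is at most
    \<open>e\<close>; the 1 covers \<open>b = 0\<close>.\<close>
  have pos: "0 < e / (2 * b + 1)" using e b by simp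
  obtain n H where H: "bounded_measurable config_space H"
    "\<And>\<omega>. \<omega> \<in> configurations \<Longrightarrow> H (\<omega> \<inter> E n) = H \<omega>"
    "Q.expectation (\<lambda>\<omega>. \<bar>h \<omega> - H \<omega>\<bar>) < e / (2 * b + 1)"
    using approximable_integrable[OF E integrable_Q[OF h]] pos by (rule approximableD) (rule that)
  \<comment> \<open>Clipping to the range of \<open>h\<close> keeps locality and does not increase
    the distance to \<open>h\<close>. It replaces the bound of \<open>H\<close>, which may depend on
    \<open>e\<close>, by the fixed \<open>b\<close> that enters the error term.\<close>
  define H' where "H' = (\<lambda>\<omega>. max (- b) (min b (H \<omega>)))"
  have H'_le: "\<bar>H' \<omega>\<bar> \<le> b" for \<omega> using b(1) by (auto simp: H'_def)
  have H': "bounded_measurable config_space H'"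
    using H(1) H'_le unfolding H'_def
    by (intro bounded_measurableI[where B = b]) (auto dest: bounded_measurableD)
  obtain M where "poisson_config_on P \<nu> M (E n) (measure \<nu> (E n))"
    using ex_poisson_config_on[OF E(2) finE] by blast
  then interpret on: poisson_config_on P \<nu> M "E n" "measure \<nu> (E n)" .
  interpret poisson_config_within_on P \<nu> B M "E n" "measure \<nu> (E n)"
    by unfold_locales (auto simp: E_def)
  let ?l = "measure \<nu> (E n)"
  have en: "bounded_measurable config_space (\<lambda>\<omega>. ?l * on.energy h \<omega>)"
    using h by (intro bounded_measurable_mult) auto
  have "Q.variance h \<le> Q.expectation (\<lambda>\<omega>. ?l * on.energy h \<omega>) + 2 * b * Q.expectation (\<lambda>\<omega>. \<bar>h \<omega> - H' \<omega>\<bar>)"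
    using H(2) b(2) H'_le by (intro Q_variance_le h H') (auto simp: H'_def)
  also have "Q.expectation (\<lambda>\<omega>. ?l * on.energy h \<omega>) \<le> c"
  proof (rule Q.integral_le_const)
    show "integrable Q (\<lambda>\<omega>. ?l * on.energy h \<omega>)" by (rule integrable_Q[OF en])
    show "AE \<omega> in Q. ?l * on.energy h \<omega> \<le> c"
      using D AE_space
    proof eventually_elim
      case (elim \<omega>)
      then have w: "\<omega> \<in> configurations" by (simp add: space_Q)
      have "ennreal (?l * on.energy h \<omega>) = (\<integral>\<^sup>+y. ennreal ((h (\<omega> \<union> {y}) - h \<omega>)\<^sup>2) * indicator (E n) y \<partial>\<nu>)"
        by (rule on.energy_eq_nn_integral[OF h w])
      also have "\<dots> \<le> (\<integral>\<^sup>+y. ennreal ((h (\<omega> \<union> {y}) - h \<omega>)\<^sup>2) * indicator B y \<partial>\<nu>)"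
        by (intro nn_integral_mono) (auto simp: E_def split: split_indicator)
      also have "\<dots> \<le> ennreal c" by (rule elim(1))
      finally show ?case using c by (simp add: ennreal_le_iff)
    qed
  qed
  also have "2 * b * Q.expectation (\<lambda>\<omega>. \<bar>h \<omega> - H' \<omega>\<bar>) \<le> e"
  proof -
    have "Q.expectation (\<lambda>\<omega>. \<bar>h \<omega> - H' \<omega>\<bar>) \<le> Q.expectation (\<lambda>\<omega>. \<bar>h \<omega> - H \<omega>\<bar>)"
    proof (rule integral_mono)
      show "integrable Q (\<lambda>\<omega>. \<bar>h \<omega> - H' \<omega>\<bar>)" "integrable Q (\<lambda>\<omega>. \<bar>h \<omega> - H \<omega>\<bar>)"
        using h H(1) H' by (auto intro!: integrable_Q)
      show "\<bar>h \<omega> - H' \<omega>\<bar> \<le> \<bar>h \<omega> - H \<omega>\<bar>" if "\<omega> \<in> space Q" for \<omega>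
        using b(2)[of \<omega>] that by (auto simp: H'_def space_Q max_def min_def)
    qed
    then have "2 * b * Q.expectation (\<lambda>\<omega>. \<bar>h \<omega> - H' \<omega>\<bar>) \<le> 2 * b * (e / (2 * b + 1))"
      using H(3) b(1) by (intro mult_left_mono) auto
    also have "\<dots> \<le> e" using e b(1) by (simp add: field_simps)
    finally show ?thesis .
  qed
  finally show "Q.variance h \<le> c + e" by simp
qed

text \<open>Returns from the conditional law to \<open>P\<close>: off the conditioning event
  everything is given away, and on it dividing by a probability only enlarges.\<close>

lemma prob_le_Q:
  assumes S: "S \<in> sets config_space"
  shows "prob S \<le> (1 - prob (void_event (- B))) + Q.prob S"
proof -
  let ?A = "void_event (- B)"
  have A: "?A \<in> sets P" "S \<in> sets P" using S by (auto simp: sets_P)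
  have "prob S \<le> prob ((space P - ?A) \<union> (?A \<inter> S))"
    using A sets.sets_into_space[OF A(2)] by (intro finite_measure_mono) auto
  also have "\<dots> \<le> prob (space P - ?A) + prob (?A \<inter> S)"
    using A by (intro measure_Un_le) auto
  also have "prob (?A \<inter> S) \<le> prob (?A \<inter> S) / prob ?A"
    using void_pos by (simp add: field_simps mult_left_le_one_le)
  also have "\<dots> = Q.prob S"
    unfolding Q_def using void_pos A by (subst measure_uniform_measure) (auto simp: emeasure_eq_measure)
  finally show ?thesis using A by (simp add: prob_compl)
qed

end

section \<open>The tail estimate\<close>

text \<open>Squaring removes both the root and the case distinction, also for an infinite
  integral.\<close>

lemma L2_enorm_power2: "(L2_enorm M f)\<^sup>2 = (\<integral>\<^sup>+y. ennreal (\<bar>f y\<bar>\<^sup>2) \<partial>M)"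
proof (cases "(\<integral>\<^sup>+y. ennreal (\<bar>f y\<bar>\<^sup>2) \<partial>M) = \<infinity>")
  case True
  then show ?thesis by (simp add: L2_enorm_def power2_eq_square)
next
  case False
  then have "(ennreal (sqrt (enn2real (\<integral>\<^sup>+y. ennreal (\<bar>f y\<bar>\<^sup>2) \<partial>M))))\<^sup>2 = (\<integral>\<^sup>+y. ennreal (\<bar>f y\<bar>\<^sup>2) \<partial>M)"
    by (subst ennreal_power) (auto simp: less_top ennreal_enn2real)
  then show ?thesis using False by (simp add: L2_enorm_def)
qed

lemma AE_nn_integral_le_Linf_L2_enorm:
  "AE \<omega> in P. (\<integral>\<^sup>+y. ennreal (\<bar>G y \<omega>\<bar>\<^sup>2) \<partial>M) \<le> (Linf_L2_enorm P M G)\<^sup>2"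
proof -
  have "AE \<omega> in P. L2_enorm M (\<lambda>y. G y \<omega>) \<le> Linf_L2_enorm P M G"
    unfolding Linf_L2_enorm_def by (rule esssup_AE)
  then show ?thesis
    by eventually_elim (simp only: L2_enorm_power2[symmetric] power_mono zero_le)
qed

lemma (in poisson_config) measurable_insert_config:
  assumes "(\<omega> :: 'a set) \<in> configurations"
  shows "(\<lambda>y. \<omega> \<union> {y}) \<in> measurable borel config_space"
proof (rule measurable_config_spaceI[OF sigma_compact_UNIV radon])
  show "\<omega> \<union> {y} \<in> configurations" for y
    using assms by (intro configurations_Un_finite) auto
  fix A :: "'a set" assume A: "A \<in> sets borel"
  have "{y \<in> space borel. (\<omega> \<union> {y}) \<inter> A = {}} = (if \<omega> \<inter> A = {} then - A else {})"
    by auto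
  then show "{y \<in> space borel. (\<omega> \<union> {y}) \<inter> A = {}} \<in> sets borel" using A by auto
qed

text \<open>Clipping is 1-Lipschitz, so the squared differences of \<open>F\<close> dominate
  pointwise. The essential supremum yields a bound almost surely under \<open>P\<close>, hence under
  \<open>Q\<close>.\<close>

lemma (in poisson_config_within) poincare_clipped:
  assumes F: "F \<in> borel_measurable config_space" and c: "0 \<le> c"
    and DF: "(Linf_L2_enorm P (density \<nu> (indicator B)) (finite_diff F))\<^sup>2 \<le> ennreal c"
  shows "Q.variance (\<lambda>\<omega>. max a (min b (F \<omega>))) \<le> c"
proof (rule poincare_inequality[OF _ c])
  let ?G = "\<lambda>\<omega>. max a (min b (F \<omega>))"
  show "bounded_measurable config_space ?G"
    using F by (intro bounded_measurableI[where B = "\<bar>a\<bar> + \<bar>b\<bar>"]) auto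
  show "AE \<omega> in Q. (\<integral>\<^sup>+y. ennreal ((?G (\<omega> \<union> {y}) - ?G \<omega>)\<^sup>2) * indicator B y \<partial>\<nu>) \<le> ennreal c"
    using AE_Q[OF AE_nn_integral_le_Linf_L2_enorm[where G = "finite_diff F" and M = "density \<nu> (indicator B)"]] AE_space
  proof eventually_elim
    case (elim \<omega>)
    then have w: "\<omega> \<in> configurations" by (simp add: space_Q)
    have "(\<lambda>y. F (\<omega> \<union> {y})) \<in> borel_measurable \<nu>"
      using measurable_compose[OF measurable_insert_config[OF w] F]
      by (simp add: sets_nu cong: measurable_cong_sets)
    then have [measurable]: "(\<lambda>y. finite_diff F y \<omega>) \<in> borel_measurable \<nu>"
      unfolding finite_diff_def by measurable
    have "(\<integral>\<^sup>+y. ennreal ((?G (\<omega> \<union> {y}) - ?G \<omega>)\<^sup>2) * indicator B y \<partial>\<nu>)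
        \<le> (\<integral>\<^sup>+y. indicator B y * ennreal (\<bar>finite_diff F y \<omega>\<bar>\<^sup>2) \<partial>\<nu>)"
    proof (intro nn_integral_mono)
      fix y
      have "\<bar>?G (\<omega> \<union> {y}) - ?G \<omega>\<bar> \<le> \<bar>finite_diff F y \<omega>\<bar>"
        unfolding finite_diff_def by linarith
      then have "(?G (\<omega> \<union> {y}) - ?G \<omega>)\<^sup>2 \<le> \<bar>finite_diff F y \<omega>\<bar>\<^sup>2"
        by (metis power2_abs power_mono abs_ge_zero)
      then show "ennreal ((?G (\<omega> \<union> {y}) - ?G \<omega>)\<^sup>2) * indicator B y
          \<le> indicator B y * ennreal (\<bar>finite_diff F y \<omega>\<bar>\<^sup>2)"
        by (auto simp: ennreal_leI split: split_indicator)
    qed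
    also have "\<dots> = (\<integral>\<^sup>+y. ennreal (\<bar>finite_diff F y \<omega>\<bar>\<^sup>2) \<partial>density \<nu> (indicator B))"
      by (rule nn_integral_density[symmetric]) (auto simp: sets_nu)
    also have "\<dots> \<le> ennreal c" using elim(1) DF by (rule order_trans)
    finally show ?case .
  qed
qed

theorem theorem5p2:
  fixes a :: "'a::metric_space"
    and \<nu> :: "'a measure" and P :: "'a set measure"
    and F :: "'a set \<Rightarrow> real"
    and \<beta> \<gamma> :: "real \<Rightarrow> real"
    and C R0 R1 m \<rho> :: real
  assumes X: "sigma_compact (UNIV :: 'a set)"
    and \<nu>: "radon_measure \<nu>" "diffuse \<nu>"
    and P: "poisson_measure \<nu> P"
    and \<gamma>: "\<forall>R\<ge>0. 0 \<le> \<gamma> R" "antimono_on {0..} \<gamma>"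
    and tail: "\<forall>R\<ge>0. R > R1 \<longrightarrow> measure P {\<omega> \<in> space P. \<omega> \<inter> - cball a R \<noteq> {}} \<le> \<gamma> R"
    and F: "F \<in> borel_measurable P"
    and \<beta>: "\<forall>R\<ge>0. 0 \<le> \<beta> R" "mono_on {0..} \<beta>"
    and C: "C > 0"
    and i: "\<forall>R\<ge>0. R > R0 \<longrightarrow>
      (AE \<omega> in P. (SUP y\<in>cball a R. ennreal \<bar>finite_diff F y \<omega>\<bar>) \<le> ennreal (\<beta> R))"
    and ii: "\<forall>R\<ge>0. R > R0 \<longrightarrow>
      (Linf_L2_enorm P (restr_measure \<nu> a R) (finite_diff F))\<^sup>2 \<le> ennreal (C * (\<beta> R)\<^sup>2 * \<gamma> R)"
    and m: "is_median P F m"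
    and \<rho>: "decr_inverse \<gamma> (1 / (2 * (1 + C * exp 1))) \<rho>"
  shows "\<forall>x>0. x \<ge> 2 * \<beta> \<rho> \<longrightarrow>
    (\<forall>r. incr_inverse \<beta> (x / 4) r \<and> max R0 R1 < max \<rho> r \<longrightarrow>
      measure P {\<omega> \<in> space P. F \<omega> - m \<ge> x} \<le> (1 + C * exp 1) * \<gamma> r)"
proof (intro allI impI, elim conjE)
  fix x r :: real
  assume x: "0 < x" and r: "incr_inverse \<beta> (x / 4) r" and R: "max R0 R1 < max \<rho> r"
  define q where "q = (1 + C * exp 1) * \<gamma> r"
  have r0: "0 \<le> r" "\<beta> r \<le> x / 4" using r by (auto simp: incr_inverse_def)
  have K: "0 < 1 + C * exp 1" using C by (simp add: add_pos_pos)
  interpret prob_space P using P by (simp add: poisson_measure_def)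
  interpret poisson_config P \<nu> by unfold_locales (fact X \<nu>(1) P)+
  have F': "F \<in> borel_measurable config_space"
    using F by (simp add: sets_P cong: measurable_cong_sets)
  note [measurable] = F
  have m': "prob {\<omega> \<in> space P. F \<omega> \<le> m} \<ge> 1 / 2" using m by (simp add: is_median_def)
  show "prob {\<omega> \<in> space P. F \<omega> - m \<ge> x} \<le> (1 + C * exp 1) * \<gamma> r"
  proof (cases "1 / 2 \<le> q")
    case True
    \<comment> \<open>As \<open>x > 0\<close>, the event lies in \<open>F > m\<close>, which has
      probability at most 1/2 by the median property; the claimed bound is then already at least
      that.\<close>
    have "prob {\<omega> \<in> space P. F \<omega> - m \<ge> x} \<le> prob (space P - {\<omega> \<in> space P. F \<omega> \<le> m})"
      using x by (intro finite_measure_mono) auto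
    also have "\<dots> \<le> 1 / 2" using m' by (subst prob_compl) auto
    finally show ?thesis using True by (simp add: q_def)
  next
    case False
    then have \<gamma>r: "\<gamma> r < 1 / (2 * (1 + C * exp 1))"
      using K by (simp add: q_def field_simps)
    \<comment> \<open>Below \<rho> the inverse forces \<open>\<gamma>\<close> to be at least the
      threshold, so \<open>r\<close> cannot lie there. Hence \<open>max \<rho> r = r\<close>, which
      puts \<open>r\<close> beyond both \<open>R0\<close> and \<open>R1\<close>.\<close>
    then have "\<rho> \<le> r" using \<rho> r0 by (force simp: decr_inverse_def)
    then have Rr: "R0 < r" "R1 < r" using R by auto
    have \<gamma>0: "0 \<le> \<gamma> r" using \<gamma>(1) r0 by simp
    \<comment> \<open>This gives the event of no points outside the ball positive probability, as
      conditioning requires.\<close>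
    have "\<gamma> r < 1"
    proof -
      have "\<gamma> r \<le> q" unfolding q_def using C \<gamma>0 by (simp add: algebra_simps)
      then show ?thesis using False by simp
    qed
    define A where "A = void_event (- cball a r)"
    have outside: "1 - prob A \<le> \<gamma> r"
    proof -
      have "space P - A = {\<omega> \<in> space P. \<omega> \<inter> - cball a r \<noteq> {}}"
        by (auto simp: A_def void_event_def space_P)
      moreover have "A \<in> sets P" by (auto simp: A_def sets_P)
      ultimately show ?thesis
        using tail r0(1) Rr(2) by (metis prob_compl)
    qed
    interpret poisson_config_within P \<nu> "cball a r"
      using outside \<open>\<gamma> r < 1\<close> by unfold_locales (auto simp: A_def)
    \<comment> \<open>The window keeps what matters for the tail: \<open>G = m + x\<close> where
      \<open>F \<ge> m + x\<close>, and \<open>G \<le> m\<close> where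
      \<open>F \<le> m\<close>.\<close>
    define G where "G = (\<lambda>\<omega>. max (m - x) (min (m + x) (F \<omega>)))"
    define c where "c = Q.expectation G"
    define v where "v = C * (\<beta> r)\<^sup>2 * \<gamma> r"
    define S where "S = {\<omega> \<in> space Q. x / 2 \<le> \<bar>G \<omega> - c\<bar>}"
    have G: "bounded_measurable config_space G"
      using F' unfolding G_def by (intro bounded_measurableI[where B = "\<bar>m - x\<bar> + \<bar>m + x\<bar>"]) auto
    have "Q.variance G \<le> v"
      unfolding G_def
    proof (rule poincare_clipped[OF F'])
      show "0 \<le> v" using C \<gamma>0 by (simp add: v_def)
      show "(Linf_L2_enorm P (density \<nu> (indicator (cball a r))) (finite_diff F))\<^sup>2 \<le> ennreal v"
        using ii r0(1) Rr(1) by (simp add: restr_measure_def v_def)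
    qed
    \<comment> \<open>The inverse was required to satisfy \<open>\<beta> r \<le> x / 4\<close> at
      the point \<open>r\<close> itself.\<close>
    also have "v \<le> C * (x / 4)\<^sup>2 * \<gamma> r"
      unfolding v_def using r0 \<beta>(1) C \<gamma>0 by (intro mult_right_mono mult_left_mono power_mono) auto
    finally have var: "Q.variance G \<le> C * (x / 4)\<^sup>2 * \<gamma> r" .
    have "Q.prob S \<le> Q.variance G / (x / 2)\<^sup>2"
      unfolding S_def c_def using G x
      by (intro Q.Chebyshev_inequality integrable_Q)
        (auto dest: bounded_measurableD simp: sets_Q cong: measurable_cong_sets)
    also have "\<dots> \<le> C * (x / 4)\<^sup>2 * \<gamma> r / (x / 2)\<^sup>2"
      using var by (rule divide_right_mono) simp
    also have "\<dots> = C * \<gamma> r / 4"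
      using x by (simp add: power2_eq_square field_simps)
    \<comment> \<open>The quotient of \<open>(x / 4)\<^sup>2\<close> by
      \<open>(x / 2)\<^sup>2\<close> is 1/4, which is below \<open>exp 1\<close>.\<close>
    also have "\<dots> \<le> C * exp 1 * \<gamma> r"
    proof -
      have "1 / 4 \<le> exp (1 :: real)" using exp_ge_add_one_self[of "1 :: real"] by simp
      then have "C * \<gamma> r * (1 / 4) \<le> C * \<gamma> r * exp 1" using C \<gamma>0 by (intro mult_left_mono) auto
      then show ?thesis by (simp add: mult_ac)
    qed
    finally have QS: "Q.prob S \<le> C * exp 1 * \<gamma> r" .
    have S: "S \<in> sets config_space"
    proof -
      have [measurable]: "G \<in> borel_measurable config_space" using G by (rule bounded_measurableD)
      have "{\<omega> \<in> space config_space. x / 2 \<le> \<bar>G \<omega> - c\<bar>} \<in> sets config_space" by measurable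
      then show ?thesis by (simp add: S_def space_Q)
    qed
    \<comment> \<open>In \<open>1 + C * exp 1\<close>, the 1 pays for points outside the ball and
      the other term for Chebyshev's inequality inside.\<close>
    have PS: "prob S \<le> q"
      using prob_le_Q[OF S] QS outside by (simp add: q_def A_def algebra_simps)
    have S': "S \<in> sets P" using S by (simp add: sets_P)
    \<comment> \<open>Otherwise \<open>G\<close> would be at least \<open>x / 2\<close> below its
      mean on all of \<open>F \<le> m\<close>, an event of probability at least 1/2, whereas
      \<open>prob S \<le> q < 1 / 2\<close>.\<close>
    have less: "c - x / 2 < m"
    proof (rule ccontr)
      assume le: "\<not> c - x / 2 < m"
      have "x / 2 \<le> \<bar>G \<omega> - c\<bar>" if "F \<omega> \<le> m" for \<omega>
      proof -
        have "G \<omega> \<le> m" using that x by (simp add: G_def)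
        then show ?thesis using le by linarith
      qed
      then have "{\<omega> \<in> space P. F \<omega> \<le> m} \<subseteq> S"
        by (auto simp: S_def space_P space_Q)
      then have "prob {\<omega> \<in> space P. F \<omega> \<le> m} \<le> prob S"
        by (intro finite_measure_mono S')
      then show False using m' PS False by simp
    qed
    have "x / 2 \<le> \<bar>G \<omega> - c\<bar>" if "F \<omega> - m \<ge> x" for \<omega>
    proof -
      have "G \<omega> = m + x" using that x by (simp add: G_def)
      then show ?thesis using less by linarith
    qed
    then have "{\<omega> \<in> space P. F \<omega> - m \<ge> x} \<subseteq> S"
      by (auto simp: S_def space_P space_Q)
    then have "prob {\<omega> \<in> space P. F \<omega> - m \<ge> x} \<le> prob S"
      by (intro finite_measure_mono S')
    then show ?thesis using PS by (simp add: q_def)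
  qed
qed

end
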